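(* For any $\alpha>2$, any randomized one-pass streaming algorithm which computes a multiplicative $(1+\varepsilon)$-approximation of the Rényi entropy $H_\alpha$ of the stream requires $\Omega\big(n^{1-2/\alpha-2\varepsilon-\gamma(\varepsilon+1/\alpha)}\big)$ bits of space, for an arbitrary constant $\gamma>0$.
   Context: A vector $A\in\mathbb{Z}^n$, initially $0$, is modified by a stream of $m$ updates $(i,v)$ with $i\in[n]$, each causing $A_i\leftarrow A_i+v$. The empirical distribution is $x_i=|A_i|/\|A\|_1$ and the Rényi entropy is $H_\alpha = \frac{1}{1-\alpha}\ln\big(\sum_i x_i^\alpha\big)$. *)

theory Defs
  imports "HOL-Probability.Probability" "HOL-Library.Landau_Symbols"
begin

type_synonym update = "nat \<times> int"

definition frequency_vector :: "update list \<Rightarrow> nat \<Rightarrow> int" where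
  "frequency_vector \<sigma> = fold (\<lambda>(i, v) A. A(i := A i + v)) \<sigma> (\<lambda>_. 0)"

text \<open>Streams of exactly \<open>m\<close> updates to a vector indexed by \<open>{1..n}\<close>. Increments are bounded
  by \<open>M\<close>: with unbounded increments the entropy takes nonzero values arbitrarily close to 0, so no
  finite memory would suffice for a multiplicative approximation and lower bounds would be vacuous.\<close>

definition update_streams :: "nat \<Rightarrow> nat \<Rightarrow> int \<Rightarrow> update list set" where
  "update_streams n m M = {\<sigma>. length \<sigma> = m \<and> (\<forall>(i, v) \<in> set \<sigma>. i \<in> {1..n} \<and> \<bar>v\<bar> \<le> M)}"

definition empirical :: "nat \<Rightarrow> (nat \<Rightarrow> int) \<Rightarrow> nat \<Rightarrow> real" where
  "empirical n A i = real_of_int \<bar>A i\<bar> / (\<Sum>j=1..n. real_of_int \<bar>A j\<bar>)"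

definition renyi_entropy :: "real \<Rightarrow> nat \<Rightarrow> (nat \<Rightarrow> int) \<Rightarrow> real" where
  "renyi_entropy \<alpha> n A = 1 / (1 - \<alpha>) * ln (\<Sum>i=1..n. empirical n A i powr \<alpha>)"

text \<open>A deterministic one-pass algorithm, whose memory content is a bit string. The first argument
  of \<open>next_memory\<close> is the number of updates already read. A randomized algorithm is a probability
  distribution over deterministic ones, i.e. the coins are tossed in advance; neither they nor
  the position in the stream are charged as space. Algorithms that toss fresh coins at each update
  are included, since their coins may depend on the position.\<close>

record stream_alg =
  init_memory :: "bool list"
  next_memory :: "nat \<Rightarrow> update \<Rightarrow> bool list \<Rightarrow> bool list"
  answer :: "bool list \<Rightarrow> real"

fun run_from :: "stream_alg \<Rightarrow> nat \<Rightarrow> bool list \<Rightarrow> update list \<Rightarrow> bool list" where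
  "run_from a k q [] = q"
| "run_from a k q (u # \<sigma>) = run_from a (Suc k) (next_memory a k u q) \<sigma>"

definition run :: "stream_alg \<Rightarrow> update list \<Rightarrow> bool list" where
  "run a \<sigma> = run_from a 0 (init_memory a) \<sigma>"

definition uses_bits :: "stream_alg pmf \<Rightarrow> nat \<Rightarrow> nat \<Rightarrow> int \<Rightarrow> nat \<Rightarrow> bool" where
  "uses_bits P n m M s \<longleftrightarrow>
     (\<forall>a \<in> set_pmf P. \<forall>\<sigma> \<in> update_streams n m M. \<forall>k \<le> m. length (run a (take k \<sigma>)) = s)"

definition mult_approx :: "real \<Rightarrow> real \<Rightarrow> real \<Rightarrow> bool" where
  "mult_approx c x y \<longleftrightarrow> x \<le> y \<and> y \<le> c * x"

text \<open>Streams ending in the zero vector are exempt, as the empirical distribution is undefined.\<close>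

definition approximates_renyi ::
    "stream_alg pmf \<Rightarrow> real \<Rightarrow> real \<Rightarrow> nat \<Rightarrow> nat \<Rightarrow> int \<Rightarrow> bool" where
  "approximates_renyi P c \<alpha> n m M \<longleftrightarrow>
     (\<forall>\<sigma> \<in> update_streams n m M. frequency_vector \<sigma> \<noteq> (\<lambda>_. 0) \<longrightarrow>
        measure_pmf.prob P
          {a. mult_approx c (renyi_entropy \<alpha> n (frequency_vector \<sigma>)) (answer a (run a \<sigma>))} \<ge> 2 / 3)"

end

(* A stream made of many distinct unit insertions has entropy close to ln n, whereas one more coordinate
   inserted n^(epsilon + 1/alpha) times makes the entropy smaller by more than a factor 1 + epsilon. So the
   algorithm tells these two situations apart (one-way multi-party set disjointness).

   Let t players own disjoint random sets of about n/t coordinates each and insert uniform random subsets of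
   them; in the second situation every player moreover inserts a common random coordinate x with
   probability 1/2. The memory contents form a Markov chain in both cases, and the divergence of the first
   chain from the second is the sum over the players of one-step divergences, each averaged over the FIRST
   chain, whose memory is independent of x. To a player, x looks like a uniform element of his set together
   with x, and s bits of memory cannot be correlated with most of n/t independent bits: by the level-one
   inequality the average one-step divergence is O(s t / n). The total O(s t^2 / n) has to be bounded
   below by a constant, so s is at least of order n / t^2 = n^(1 - 2/alpha - 2 epsilon). *)
theory Submission
  imports Defs
begin

section \<open>Information revealed by a function of random bits\<close>

definition subset_mean :: "'b set \<Rightarrow> ('b set \<Rightarrow> real) \<Rightarrow> real" where
  "subset_mean S \<phi> = (\<Sum>B\<in>Pow S. \<phi> B) / 2 ^ card S"

text \<open>The degree-one Fourier coefficient of \<open>G\<close>, normalised by the size of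
  \<open>G\<close>. Division by zero makes it 0 for empty \<open>G\<close>.\<close>

definition bias :: "'b set set \<Rightarrow> 'b \<Rightarrow> real" where
  "bias G x = (\<Sum>B\<in>G. if x \<in> B then - 1 else 1) / card G"

definition fiber :: "('b set \<Rightarrow> 'q) \<Rightarrow> 'b set \<Rightarrow> 'q \<Rightarrow> 'b set set" where
  "fiber f T y = {B \<in> Pow T. f B = y}"

text \<open>\<open>leak f T x\<close> is the Kullback-Leibler divergence from the law of \<open>f B\<close>, with \<open>B\<close> a uniform
  subset of \<open>T - {x}\<close>, to the law with \<open>B\<close> a uniform subset of \<open>T\<close>: at the value \<open>y\<close> the
  likelihood ratio of the two is \<open>1 + bias (fiber f T y) x\<close>.\<close>

definition leak :: "('b set \<Rightarrow> 'q) \<Rightarrow> 'b set \<Rightarrow> 'b \<Rightarrow> real" where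
  "leak f T x = subset_mean (T - {x}) (\<lambda>B. ln (1 + bias (fiber f T (f B)) x))"

section \<open>Biases of subsets of the cube and the level-one inequality\<close>

text \<open>Concavity: the tangent of \<open>ln\<close> at \<open>c\<close>. It stands in for
  Jensen's inequality throughout, with \<open>c\<close> a bound or a guess for the mean of
  \<open>z\<close>.\<close>

lemma ln_le_tangent:
  fixes c z :: real
  assumes "c > 0" "z > 0"
  shows "ln z \<le> ln c - 1 + z / c"
  using ln_le_minus_one[of "z / c"] assms by (simp add: ln_div)

lemma abs_bias_le_1: "\<bar>bias G x\<bar> \<le> 1"
proof -
  have "\<bar>\<Sum>B\<in>G. if x \<in> B then - 1 else 1 :: real\<bar> \<le> (\<Sum>B\<in>G. 1)"
    by (rule order_trans[OF sum_abs]) (rule sum_mono, simp)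
  then show ?thesis
    unfolding bias_def by (cases "card G = 0") (auto simp: abs_divide divide_le_eq)
qed

lemma card_mult_bias:
  assumes "finite G"
  shows "card G * bias G x = (\<Sum>B\<in>G. if x \<in> B then - 1 else 1)"
  using assms by (cases "G = {}") (auto simp: bias_def)

text \<open>Adding 1 to the sign gives twice the indicator of missing \<open>x\<close>. So for
  nonempty \<open>G\<close>, \<open>1 + bias G x\<close> is the probability of missing
  \<open>x\<close> within \<open>G\<close>, relative to 1/2.\<close>

lemma card_mult_one_plus_bias:
  assumes "finite G"
  shows "card G * (1 + bias G x) = 2 * card {B \<in> G. x \<notin> B}"
proof -
  have "card G * (1 + bias G x) = (\<Sum>B\<in>G. 1 + (if x \<in> B then - 1 else 1))"
    unfolding sum.distrib by (simp add: distrib_left card_mult_bias[OF assms])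
  also have "\<dots> = (\<Sum>B\<in>G. if x \<notin> B then 2 else 0)"
    by (rule sum.cong) auto
  also have "\<dots> = 2 * card {B \<in> G. x \<notin> B}"
    using assms by (simp add: sum.If_cases Int_def)
  finally show ?thesis .
qed

text \<open>Level-one inequality: a set of density \<open>p\<close> in the cube has total squared bias \<open>O(ln (1/p))\<close>.
  The product density \<open>w\<close> in the proof is tilted by the biases of \<open>G\<close> itself; as it has mean 1 on the cube,
  its mean on \<open>G\<close> is at most \<open>1/p\<close>, and Jensen bounds the mean of \<open>ln w\<close> on \<open>G\<close>.\<close>

lemma sum_bias_square_le:
  assumes T: "finite T" and G: "G \<subseteq> Pow T" "G \<noteq> {}"
  shows "card G * (\<Sum>x\<in>T. (bias G x)\<^sup>2) \<le> 8 * (card G * ln (2 ^ card T / card G))"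
proof -
  define sg :: "'a \<Rightarrow> 'a set \<Rightarrow> real" where "sg = (\<lambda>x B. if x \<in> B then - 1 else 1)"
  \<comment> \<open>For a bias b, the choice b / 4 maximises b z - 2 z^2 over z, with value b^2 / 8.
    It also keeps the tilts below 1/2, where ln (1 + z) \<ge> z - 2 z^2.\<close>
  define \<theta> where "\<theta> = (\<lambda>x. bias G x / 4)"
  define w where "w = (\<lambda>B. \<Prod>x\<in>T. 1 + \<theta> x * sg x B)"
  have finG: "finite G" using G T by (meson finite_Pow_iff finite_subset)
  have g0: "real (card G) > 0" using finG G by (simp add: card_gt_0_iff)
  have th: "\<bar>\<theta> x * sg x B\<bar> \<le> 1 / 2" for x B
    using abs_bias_le_1[of G x] by (simp add: \<theta>_def sg_def abs_mult)
  have pos: "1 + \<theta> x * sg x B > 0" for x B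
    using th[of x B] by linarith
  have wpos: "w B > 0" for B unfolding w_def using pos by (intro prod_pos) auto
  have "(\<Sum>B\<in>Pow T. w B) = 2 ^ card T"
  proof -
    \<comment> \<open>Sorting the factors by membership in \<open>B\<close> exhibits the sum as the
      expansion of a product whose factors all equal 2.\<close>
    have "(\<Sum>B\<in>Pow T. w B) = (\<Sum>B\<in>Pow T. (\<Prod>x\<in>B. 1 - \<theta> x) * (\<Prod>x\<in>T - B. 1 + \<theta> x))"
    proof (rule sum.cong)
      fix B assume B: "B \<in> Pow T"
      have "w B = (\<Prod>x\<in>B. 1 + \<theta> x * sg x B) * (\<Prod>x\<in>T - B. 1 + \<theta> x * sg x B)"
        unfolding w_def using B prod.subset_diff[OF _ T, of B] by (simp add: mult.commute)
      then show "w B = (\<Prod>x\<in>B. 1 - \<theta> x) * (\<Prod>x\<in>T - B. 1 + \<theta> x)"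
        by (simp add: sg_def)
    qed simp
    also have "\<dots> = (\<Prod>x\<in>T. (1 - \<theta> x) + (1 + \<theta> x))"
      by (rule prod_add[OF T, symmetric])
    finally show ?thesis by simp
  qed
  moreover have "sum w G \<le> sum w (Pow T)"
    using G T wpos by (intro sum_mono2) (auto simp: less_imp_le)
  ultimately have wG: "sum w G \<le> 2 ^ card T" by simp
  define c where "c = 2 ^ card T / real (card G)"
  have c0: "c > 0" using g0 by (simp add: c_def)
  have "(\<Sum>B\<in>G. ln (w B)) \<le> (\<Sum>B\<in>G. ln c - 1 + w B / c)"
    by (intro sum_mono ln_le_tangent c0 wpos)
  also have "\<dots> = card G * (ln c - 1) + sum w G / c"
    by (simp add: sum.distrib sum_divide_distrib sum_subtractf right_diff_distrib)
  also have "sum w G / c \<le> 2 ^ card T / c"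
    using wG c0 by (simp add: divide_right_mono)
  also have "2 ^ card T / c = card G" using g0 by (simp add: c_def)
  finally have upper: "(\<Sum>B\<in>G. ln (w B)) \<le> card G * ln c" by (simp add: right_diff_distrib)
  have "card G * (\<Sum>x\<in>T. (bias G x)\<^sup>2) / 8 = (\<Sum>x\<in>T. card G * ((bias G x)\<^sup>2 / 8))"
    by (simp add: sum_distrib_left sum_divide_distrib)
  also have "\<dots> = (\<Sum>x\<in>T. \<Sum>B\<in>G. \<theta> x * sg x B - 2 * (\<theta> x)\<^sup>2)"
  proof (rule sum.cong)
    fix x
    have "(\<Sum>B\<in>G. \<theta> x * sg x B - 2 * (\<theta> x)\<^sup>2) = \<theta> x * (card G * bias G x) - card G * (2 * (\<theta> x)\<^sup>2)"
      by (simp add: sum_subtractf sum_distrib_left[symmetric] card_mult_bias[OF finG] sg_def)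
    also have "\<dots> = card G * ((bias G x)\<^sup>2 / 8)"
      by (simp add: \<theta>_def power2_eq_square field_simps)
    finally show "card G * ((bias G x)\<^sup>2 / 8) = (\<Sum>B\<in>G. \<theta> x * sg x B - 2 * (\<theta> x)\<^sup>2)" ..
  qed simp
  also have "\<dots> = (\<Sum>B\<in>G. \<Sum>x\<in>T. \<theta> x * sg x B - 2 * (\<theta> x)\<^sup>2)" by (rule sum.swap)
  also have "\<dots> \<le> (\<Sum>B\<in>G. ln (w B))"
  proof (rule sum_mono)
    fix B
    have "(\<Sum>x\<in>T. \<theta> x * sg x B - 2 * (\<theta> x)\<^sup>2) \<le> (\<Sum>x\<in>T. ln (1 + \<theta> x * sg x B))"
    proof (rule sum_mono)
      fix x
      have "(\<theta> x * sg x B)\<^sup>2 = (\<theta> x)\<^sup>2" by (auto simp: sg_def)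
      then show "\<theta> x * sg x B - 2 * (\<theta> x)\<^sup>2 \<le> ln (1 + \<theta> x * sg x B)"
        using abs_ln_one_plus_x_minus_x_bound[OF th[of x B]] by linarith
    qed
    also have "\<dots> = ln (w B)"
      unfolding w_def by (rule ln_prod[symmetric, OF T]) (metis pos less_irrefl)
    finally show "(\<Sum>x\<in>T. \<theta> x * sg x B - 2 * (\<theta> x)\<^sup>2) \<le> ln (w B)" .
  qed
  finally show ?thesis using upper by (simp add: c_def)
qed

section \<open>Chi-square and entropy bounds for \<open>leak\<close>\<close>

lemma sum_fibers:
  assumes "finite T"
  shows "(\<Sum>y\<in>f ` Pow T. \<Sum>B\<in>fiber f T y. \<phi> B) = (\<Sum>B\<in>Pow T. \<phi> B :: real)"
  unfolding fiber_def using sum.image_gen[of "Pow T" \<phi> f] assms by simp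

lemma finite_fiber: "finite T \<Longrightarrow> finite (fiber f T y)"
  by (simp add: fiber_def)

lemma sum_sign_Pow:
  assumes "finite T" "x \<in> T"
  shows "(\<Sum>B\<in>Pow T. if x \<in> B then - 1 else 1 :: real) = 0"
proof -
  obtain S where S: "T = insert x S" "x \<notin> S" using assms by (meson mk_disjoint_insert)
  have "(\<Sum>B\<in>insert x ` Pow S. if x \<in> B then - 1 else 1 :: real)
      = (\<Sum>B\<in>Pow S. if x \<in> insert x B then - 1 else 1)"
    using S by (subst sum.reindex) (auto intro!: inj_onI)
  moreover have "(\<Sum>B\<in>Pow S. if x \<in> B then - 1 else 1 :: real) = (\<Sum>B\<in>Pow S. 1)"
    using S by (intro sum.cong) auto
  moreover have "Pow S \<inter> insert x ` Pow S = {}" using S by auto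
  ultimately show ?thesis
    using assms S by (simp add: Pow_insert sum.union_disjoint)
qed

text \<open>A Kullback-Leibler divergence is at most the chi-square divergence, here the right-hand
  side: ln (1 + b) \<le> b leaves b + b^2, and the linear terms cancel over the whole cube.\<close>

lemma leak_le:
  assumes T: "finite T" and x: "x \<in> T"
  shows "leak f T x \<le> (\<Sum>y\<in>f ` Pow T. card (fiber f T y) * (bias (fiber f T y) x)\<^sup>2) / 2 ^ card T"
proof -
  let ?g = "\<lambda>y. real (card (fiber f T y))" and ?b = "\<lambda>y. bias (fiber f T y) x"
  have cT: "(2::real) ^ card T = 2 * 2 ^ card (T - {x})"
    using T x by (metis card_Suc_Diff1 power_Suc)
  \<comment> \<open>The subsets of \<open>T - {x}\<close> are the subsets of \<open>T\<close> that
    miss \<open>x\<close>, so the sum can be sorted by the fibers over \<open>Pow T\<close>.\<close>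
  have "(\<Sum>B\<in>Pow (T - {x}). ln (1 + ?b (f B))) = (\<Sum>B\<in>Pow T. if x \<notin> B then ln (1 + ?b (f B)) else 0)"
    using T by (subst sum.If_cases) (auto intro!: sum.cong)
  also have "\<dots> = (\<Sum>y\<in>f ` Pow T. \<Sum>B\<in>fiber f T y. if x \<notin> B then ln (1 + ?b (f B)) else 0)"
    by (rule sum_fibers[OF T, symmetric])
  also have "\<dots> = (\<Sum>y\<in>f ` Pow T. \<Sum>B\<in>fiber f T y. if x \<notin> B then ln (1 + ?b y) else 0)"
    by (intro sum.cong refl) (auto simp: fiber_def)
  also have "\<dots> = (\<Sum>y\<in>f ` Pow T. card {B \<in> fiber f T y. x \<notin> B} * ln (1 + ?b y))"
    using T by (simp add: sum.If_cases finite_fiber Int_def)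
  finally have "2 * (\<Sum>B\<in>Pow (T - {x}). ln (1 + ?b (f B)))
      = (\<Sum>y\<in>f ` Pow T. (2 * card {B \<in> fiber f T y. x \<notin> B}) * ln (1 + ?b y))"
    by (simp add: sum_distrib_left mult.assoc)
  also have "\<dots> = (\<Sum>y\<in>f ` Pow T. ?g y * (1 + ?b y) * ln (1 + ?b y))"
    using T by (simp add: card_mult_one_plus_bias finite_fiber)
  also have "\<dots> \<le> (\<Sum>y\<in>f ` Pow T. ?g y * ?b y + ?g y * (?b y)\<^sup>2)"
  proof (rule sum_mono)
    fix y
    have "(1 + ?b y) * ln (1 + ?b y) \<le> (1 + ?b y) * ?b y"
    proof (cases "1 + ?b y = 0")
      case False
      then have "- 1 < ?b y" using abs_bias_le_1[of "fiber f T y" x] by linarith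
      then show ?thesis by (intro mult_left_mono ln_add_one_self_le_self2) auto
    qed simp
    then have "?g y * ((1 + ?b y) * ln (1 + ?b y)) \<le> ?g y * ((1 + ?b y) * ?b y)"
      by (rule mult_left_mono) simp
    then show "?g y * (1 + ?b y) * ln (1 + ?b y) \<le> ?g y * ?b y + ?g y * (?b y)\<^sup>2"
      by (simp add: algebra_simps power2_eq_square)
  qed
  also have "\<dots> = (\<Sum>y\<in>f ` Pow T. ?g y * (?b y)\<^sup>2)"
    using sum_fibers[OF T, where f = f and \<phi> = "\<lambda>B. if x \<in> B then - 1 else 1"] sum_sign_Pow[OF T x] T
    by (simp add: sum.distrib card_mult_bias finite_fiber)
  finally show ?thesis
    unfolding leak_def subset_mean_def cT by (simp add: field_simps)
qed

text \<open>On a fiber of density p, the level-one inequality bounds the total squared bias by 8 ln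
  (1/p). Averaged over the fibers, ln (1/p) is the Shannon entropy of \<open>f B\<close>, at most
  the logarithm of the number of values.\<close>

lemma sum_leak_le:
  assumes T: "finite T" and Y: "finite Y" "f ` Pow T \<subseteq> Y"
  shows "(\<Sum>x\<in>T. leak f T x) \<le> 8 * ln (card Y)"
proof -
  let ?g = "\<lambda>y. real (card (fiber f T y))" and ?V = "2 ^ card T :: real"
  have N: "real (card Y) > 0" using Y by (auto simp: card_gt_0_iff)
  have g0: "?g y > 0" if "y \<in> f ` Pow T" for y
    using that T by (auto simp: card_gt_0_iff fiber_def)
  have "(\<Sum>x\<in>T. leak f T x) \<le> (\<Sum>x\<in>T. (\<Sum>y\<in>f ` Pow T. ?g y * (bias (fiber f T y) x)\<^sup>2) / ?V)"
    by (intro sum_mono leak_le T)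
  also have "\<dots> = (\<Sum>y\<in>f ` Pow T. ?g y * (\<Sum>x\<in>T. (bias (fiber f T y) x)\<^sup>2)) / ?V"
    unfolding sum_divide_distrib[symmetric] sum_distrib_left by (subst sum.swap) simp
  also have "\<dots> \<le> (\<Sum>y\<in>f ` Pow T. 8 * (?g y * ln (?V / ?g y))) / ?V"
  proof (intro divide_right_mono sum_mono)
    fix y assume "y \<in> f ` Pow T"
    then show "?g y * (\<Sum>x\<in>T. (bias (fiber f T y) x)\<^sup>2) \<le> 8 * (?g y * ln (?V / ?g y))"
      by (intro sum_bias_square_le T) (auto simp: fiber_def)
  qed simp
  \<comment> \<open>The entropy bound, by the tangent at \<open>card Y\<close>. After summation the
    terms \<open>?V / card Y\<close> total at most \<open>?V\<close>, which is the sum of the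
    \<open>?g y\<close>.\<close>
  also have "\<dots> \<le> (\<Sum>y\<in>f ` Pow T. 8 * (?g y * ln (card Y) + (?V / card Y - ?g y))) / ?V"
  proof (intro divide_right_mono sum_mono mult_left_mono)
    fix y assume y: "y \<in> f ` Pow T"
    have "ln (?V / ?g y) \<le> ln (card Y) - 1 + ?V / ?g y / card Y"
      using N g0[OF y] by (intro ln_le_tangent) auto
    then have "?g y * ln (?V / ?g y) \<le> ?g y * (ln (card Y) - 1 + ?V / ?g y / card Y)"
      by (intro mult_left_mono) auto
    also have "\<dots> = ?g y * ln (card Y) + (?V / card Y - ?g y)"
      using g0[OF y] by (simp add: field_simps)
    finally show "?g y * ln (?V / ?g y) \<le> ?g y * ln (card Y) + (?V / card Y - ?g y)" .
  qed auto
  also have "\<dots> = 8 * ((\<Sum>y\<in>f ` Pow T. ?g y) * ln (card Y) + card (f ` Pow T) * (?V / card Y)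
      - (\<Sum>y\<in>f ` Pow T. ?g y)) / ?V"
    by (simp add: sum.distrib sum_subtractf sum_distrib_left[symmetric] sum_distrib_right)
  also have "(\<Sum>y\<in>f ` Pow T. ?g y) = ?V"
    using sum_fibers[OF T, where f = f and \<phi> = "\<lambda>_. 1"] T by (simp add: card_Pow)
  also have "8 * (?V * ln (card Y) + card (f ` Pow T) * (?V / card Y) - ?V) / ?V \<le> 8 * ln (card Y)"
  proof -
    have "real (card (f ` Pow T)) \<le> card Y" using Y by (simp add: card_mono)
    then have "real (card (f ` Pow T)) * (?V / card Y) \<le> card Y * (?V / card Y)"
      by (intro mult_right_mono) auto
    then have "card (f ` Pow T) * (?V / card Y) \<le> ?V" using N by simp
    then have "8 * (?V * ln (card Y) + card (f ` Pow T) * (?V / card Y) - ?V) / ?V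
        \<le> 8 * (?V * ln (card Y)) / ?V"
      by (intro divide_right_mono) auto
    then show ?thesis by simp
  qed
  finally show ?thesis .
qed

text \<open>The Donsker-Varadhan inequality for a single step.\<close>

lemma subset_mean_ln_le:
  assumes S: "finite S" "x \<notin> S" and G: "\<And>y. G y > 0"
  shows "subset_mean S (\<lambda>B. ln (G (f B)))
      \<le> leak f (insert x S) x + ln (subset_mean (insert x S) (\<lambda>B. G (f B)))"
proof -
  let ?T = "insert x S"
  let ?g = "\<lambda>y. real (card (fiber f ?T y))" and ?b = "\<lambda>y. bias (fiber f ?T y) x"
  define Z where "Z = subset_mean ?T (\<lambda>B. G (f B))"
  have T: "finite ?T" using S by simp
  have Z0: "Z > 0" unfolding Z_def subset_mean_def using G T by (intro divide_pos_pos sum_pos) auto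
  have fib: "{B \<in> fiber f ?T y. x \<notin> B} = fiber f S y" for y
    using S by (auto simp: fiber_def)
  have gb: "?g y * (1 + ?b y) = 2 * card (fiber f S y)" for y
    using card_mult_one_plus_bias[OF finite_fiber[OF T], of f y x] fib by simp
  have c0: "card (fiber f S y) > 0" if "y \<in> f ` Pow S" for y
    using that S by (auto simp: card_gt_0_iff fiber_def)
  have b0: "1 + ?b y > 0" if "y \<in> f ` Pow S" for y
  proof -
    have "?g y * (1 + ?b y) > 0" using gb[of y] c0[OF that] by simp
    then show ?thesis by (simp add: zero_less_mult_iff)
  qed
  have "(\<Sum>B\<in>Pow S. ln (G (f B))) \<le> (\<Sum>B\<in>Pow S. ln (1 + ?b (f B)) + (ln Z - 1) + G (f B) / (1 + ?b (f B)) / Z)"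
  proof (rule sum_mono)
    fix B assume "B \<in> Pow S"
    then have b: "1 + ?b (f B) > 0" using b0 by blast
    \<comment> \<open>Dividing by the likelihood ratio changes the measure: the quotient has mean at
      most \<open>Z\<close> over \<open>Pow S\<close>, hence the tangent at
      \<open>Z\<close>.\<close>
    then have "ln (G (f B) / (1 + ?b (f B))) \<le> ln Z - 1 + G (f B) / (1 + ?b (f B)) / Z"
      using G Z0 by (intro ln_le_tangent) auto
    then show "ln (G (f B)) \<le> ln (1 + ?b (f B)) + (ln Z - 1) + G (f B) / (1 + ?b (f B)) / Z"
      using b ln_divide_pos[OF G b, of "f B"] by simp
  qed
  also have "\<dots> = (\<Sum>B\<in>Pow S. ln (1 + ?b (f B))) + 2 ^ card S * (ln Z - 1)
      + (\<Sum>B\<in>Pow S. G (f B) / (1 + ?b (f B))) / Z"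
    using S by (simp add: sum.distrib card_Pow sum_divide_distrib)
  also have "(\<Sum>B\<in>Pow S. G (f B) / (1 + ?b (f B))) \<le> 2 ^ card S * Z"
  proof -
    have "(\<Sum>B\<in>Pow S. G (f B) / (1 + ?b (f B)))
        = (\<Sum>y\<in>f ` Pow S. \<Sum>B\<in>fiber f S y. G (f B) / (1 + ?b (f B)))"
      by (rule sum_fibers[OF S(1), symmetric])
    also have "\<dots> = (\<Sum>y\<in>f ` Pow S. \<Sum>B\<in>fiber f S y. G y / (1 + ?b y))"
      by (intro sum.cong refl) (auto simp: fiber_def)
    also have "\<dots> = (\<Sum>y\<in>f ` Pow S. ?g y * G y / 2)"
    proof (rule sum.cong)
      fix y assume y: "y \<in> f ` Pow S"
      show "(\<Sum>B\<in>fiber f S y. G y / (1 + ?b y)) = ?g y * G y / 2"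
        using gb[of y] b0[OF y] by (simp add: field_simps)
    qed simp
    \<comment> \<open>Values of \<open>f\<close> attained only on sets containing \<open>x\<close>
      join the sum here; \<open>G\<close> is positive.\<close>
    also have "\<dots> \<le> (\<Sum>y\<in>f ` Pow ?T. ?g y * G y / 2)"
      using T G by (intro sum_mono2) (auto intro!: mult_nonneg_nonneg less_imp_le[OF G])
    also have "\<dots> = (\<Sum>y\<in>f ` Pow ?T. \<Sum>B\<in>fiber f ?T y. G (f B)) / 2"
      by (simp add: sum_divide_distrib fiber_def)
    also have "\<dots> = (\<Sum>B\<in>Pow ?T. G (f B)) / 2"
      by (simp only: sum_fibers[OF T])
    also have "\<dots> = 2 ^ card S * Z"
      using S by (simp add: Z_def subset_mean_def)
    finally show ?thesis .
  qed
  then have "(\<Sum>B\<in>Pow S. G (f B) / (1 + ?b (f B))) / Z \<le> 2 ^ card S"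
    using Z0 by (simp add: divide_le_eq)
  finally have "(\<Sum>B\<in>Pow S. ln (G (f B))) \<le> (\<Sum>B\<in>Pow S. ln (1 + ?b (f B))) + 2 ^ card S * ln Z"
    by (simp add: right_diff_distrib)
  moreover have "?T - {x} = S" using S by auto
  ultimately show ?thesis
    unfolding leak_def subset_mean_def Z_def[unfolded subset_mean_def, symmetric]
    by (simp add: field_simps)
qed

section \<open>Chains of memory states\<close>

text \<open>Expectation over independent uniform subsets of the listed sets, one set per player. The
  first player is outermost, so the chain rule goes by induction on the list.\<close>

fun mean :: "'b set list \<Rightarrow> ('b set list \<Rightarrow> real) \<Rightarrow> real" where
  "mean [] \<phi> = \<phi> []"
| "mean (S # Ss) \<phi> = subset_mean S (\<lambda>B. mean Ss (\<lambda>Bs. \<phi> (B # Bs)))"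

text \<open>The memory after all players have acted. The player's number \<open>i\<close> is passed
  to \<open>F\<close> because an algorithm may depend on its position in the stream.\<close>

fun drive :: "(nat \<Rightarrow> 'b set \<Rightarrow> 'q \<Rightarrow> 'q) \<Rightarrow> nat \<Rightarrow> 'q \<Rightarrow> 'b set list \<Rightarrow> 'q" where
  "drive F i q [] = q"
| "drive F i q (B # Bs) = drive F (Suc i) (F i B q) Bs"

section \<open>Calculus of the iterated mean\<close>

lemma subset_mean_mono:
  "(\<And>B. B \<subseteq> S \<Longrightarrow> \<phi> B \<le> \<psi> B) \<Longrightarrow> subset_mean S \<phi> \<le> subset_mean S \<psi>"
  unfolding subset_mean_def by (intro divide_right_mono sum_mono) auto

lemma subset_mean_add: "subset_mean S (\<lambda>B. \<phi> B + \<psi> B) = subset_mean S \<phi> + subset_mean S \<psi>"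
  by (simp add: subset_mean_def sum.distrib add_divide_distrib)

lemma subset_mean_cmult: "subset_mean S (\<lambda>B. c * \<phi> B) = c * subset_mean S \<phi>"
  by (simp add: subset_mean_def sum_distrib_left)

lemma subset_mean_sum: "subset_mean S (\<lambda>B. \<Sum>k\<in>A. \<phi> k B) = (\<Sum>k\<in>A. subset_mean S (\<phi> k))"
  unfolding subset_mean_def by (subst sum.swap) (simp add: sum_divide_distrib)

lemma subset_mean_const: "finite S \<Longrightarrow> subset_mean S (\<lambda>_. c) = c"
  by (simp add: subset_mean_def card_Pow)

text \<open>Only lists of subsets of the given sets are compared, so facts about admissible inputs
  can be used under \<open>mean\<close>.\<close>

lemma mean_mono:
  "(\<And>Bs. list_all2 (\<subseteq>) Bs Ss \<Longrightarrow> \<phi> Bs \<le> \<psi> Bs) \<Longrightarrow> mean Ss \<phi> \<le> mean Ss \<psi>"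
proof (induction Ss arbitrary: \<phi> \<psi>)
  case (Cons S Ss)
  show ?case
    unfolding mean.simps by (intro subset_mean_mono Cons.IH Cons.prems) simp
qed simp

lemma mean_add: "mean Ss (\<lambda>Bs. \<phi> Bs + \<psi> Bs) = mean Ss \<phi> + mean Ss \<psi>"
  by (induction Ss arbitrary: \<phi> \<psi>) (simp_all add: subset_mean_add)

lemma mean_cmult: "mean Ss (\<lambda>Bs. c * \<phi> Bs) = c * mean Ss \<phi>"
  by (induction Ss arbitrary: \<phi>) (simp_all add: subset_mean_cmult)

lemma mean_sum: "mean Ss (\<lambda>Bs. \<Sum>k\<in>A. \<phi> k Bs) = (\<Sum>k\<in>A. mean Ss (\<phi> k))"
  by (induction Ss arbitrary: \<phi>) (simp_all add: subset_mean_sum)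

lemma mean_const: "(\<And>S. S \<in> set Ss \<Longrightarrow> finite S) \<Longrightarrow> mean Ss (\<lambda>_. c) = c"
  by (induction Ss) (simp_all add: subset_mean_const)

lemma mean_pos:
  assumes "\<And>S. S \<in> set Ss \<Longrightarrow> finite S" "\<And>Bs. \<phi> Bs > 0"
  shows "mean Ss \<phi> > 0"
  using assms
proof (induction Ss arbitrary: \<phi>)
  case (Cons S Ss)
  have "mean Ss (\<lambda>Bs. \<phi> (B # Bs)) > 0" for B using Cons by simp
  then show ?case
    using Cons.prems(1)[of S] by (auto simp: subset_mean_def intro!: divide_pos_pos sum_pos)
qed simp

text \<open>The chain rule: every divergence is averaged over the trajectories of the first law only, in
  which no player inserts \<open>x\<close>. Hence the memory reached before step \<open>l\<close> carries no information on \<open>x\<close>.\<close>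

lemma mean_ln_le:
  assumes "\<And>S. S \<in> set Ss \<Longrightarrow> finite S \<and> x \<notin> S" and G: "\<And>y. G y > 0"
  shows "mean Ss (\<lambda>Bs. ln (G (drive F i q Bs)))
      \<le> ln (mean (map (insert x) Ss) (\<lambda>Bs. G (drive F i q Bs)))
        + (\<Sum>l<length Ss. mean (take l Ss)
             (\<lambda>Bs. leak (\<lambda>B. F (i + l) B (drive F i q Bs)) (insert x (Ss ! l)) x))"
  using assms(1)
proof (induction Ss arbitrary: i q)
  case (Cons S Ss)
  \<comment> \<open>\<open>G'\<close> is the mean of \<open>G\<close> under the second law, given
    the memory after the first player. It is the test function for the first step; the induction
    hypothesis covers the remaining steps.\<close>
  define G' where "G' = (\<lambda>q. mean (map (insert x) Ss) (\<lambda>Bs. G (drive F (Suc i) q Bs)))"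
  define R where "R = (\<lambda>l q. mean (take l Ss)
    (\<lambda>Bs. leak (\<lambda>B. F (Suc i + l) B (drive F (Suc i) q Bs)) (insert x (Ss ! l)) x))"
  have S: "finite S" "x \<notin> S" using Cons.prems by auto
  have G'0: "G' y > 0" for y
    unfolding G'_def using Cons.prems G by (intro mean_pos) auto
  have "mean (S # Ss) (\<lambda>Bs. ln (G (drive F i q Bs)))
      \<le> subset_mean S (\<lambda>B. ln (G' (F i B q)) + (\<Sum>l<length Ss. R l (F i B q)))"
    unfolding mean.simps drive.simps G'_def R_def
    using Cons.prems by (intro subset_mean_mono Cons.IH) simp
  also have "\<dots> = subset_mean S (\<lambda>B. ln (G' (F i B q)))
      + (\<Sum>l<length Ss. subset_mean S (\<lambda>B. R l (F i B q)))"
    by (simp add: subset_mean_add subset_mean_sum)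
  also have "subset_mean S (\<lambda>B. ln (G' (F i B q)))
      \<le> leak (\<lambda>B. F i B q) (insert x S) x + ln (subset_mean (insert x S) (\<lambda>B. G' (F i B q)))"
    by (rule subset_mean_ln_le[OF S G'0])
  finally show ?case
    by (simp add: G'_def R_def sum.lessThan_Suc_shift del: sum.lessThan_Suc)
qed simp

text \<open>Replacing \<open>p\<close> by \<open>p \<circ> transpose e k\<close> with \<open>k \<in> blk l\<close> preserves the sets of the players before
  \<open>l\<close> and the set \<open>insert (p e) (p ` blk l)\<close>, but moves the secret element to \<open>p k\<close>. So the secret is
  uniform among the elements of that set, whose leaks have a bounded sum.\<close>

lemma sum_permutations_mean_leak_le:
  fixes V :: "'b set"
  assumes V: "finite V" "e \<in> V" and blk: "\<And>l. l < t \<Longrightarrow> blk l \<subseteq> V - {e}"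
    and disj: "\<And>l l'. l < t \<Longrightarrow> l' < t \<Longrightarrow> l \<noteq> l' \<Longrightarrow> blk l \<inter> blk l' = {}"
    and card: "card (blk l) = L" and Y: "finite Y" "\<And>i B q. F i B q \<in> Y" and l: "l < t"
  shows "(L + 1) * (\<Sum>p | p permutes V. mean (map (\<lambda>l. p ` blk l) [0..<l])
      (\<lambda>Bs. leak (\<lambda>B. F l B (drive F 0 q Bs)) (insert (p e) (p ` blk l)) (p e)))
    \<le> card {p. p permutes V} * (8 * ln (card Y))"
proof -
  define f where "f = (\<lambda>Bs B. F l B (drive F 0 q Bs))"
  define h where "h = (\<lambda>p k. mean (map (\<lambda>l. p ` blk l) [0..<l])
    (\<lambda>Bs. leak (f Bs) (p ` insert e (blk l)) (p k)))"
  have fin: "finite (blk l')" if "l' < t" for l' using blk[OF that] V by (meson finite_Diff finite_subset)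
  have eq: "(\<Sum>p | p permutes V. h p e) = (\<Sum>p | p permutes V. h p k)" if k: "k \<in> insert e (blk l)" for k
  proof -
    have kV: "k \<in> V" using k V blk[OF l] by auto
    have "(\<Sum>p | p permutes V. h p e) = (\<Sum>p | p permutes V. h (p \<circ> Transposition.transpose e k) e)"
      by (rule sum_permutations_compose_right) (use V kV in \<open>simp add: permutes_swap_id\<close>)
    also have "\<dots> = (\<Sum>p | p permutes V. h p k)"
    proof (rule sum.cong)
      fix p :: "'b \<Rightarrow> 'b"
      have "Transposition.transpose e k ` blk l' = blk l'" if "l' < l" for l'
      proof (rule image_cong[THEN trans, OF refl _ image_ident])
        fix z assume "z \<in> blk l'"
        moreover have "e \<notin> blk l'" using blk[of l'] that l by auto
        moreover have "k \<notin> blk l'" using k disj[of l l'] that l calculation(2) by auto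
        ultimately show "Transposition.transpose e k z = z" by (intro transpose_apply_other) auto
      qed
      then have "(p \<circ> Transposition.transpose e k) ` blk l' = p ` blk l'" if "l' < l" for l'
        using that by (metis image_comp)
      then have "map (\<lambda>l. (p \<circ> Transposition.transpose e k) ` blk l) [0..<l] = map (\<lambda>l. p ` blk l) [0..<l]"
        by (intro map_cong refl) simp
      moreover have "Transposition.transpose e k ` insert e (blk l) = insert e (blk l)"
        using k by (intro transpose_image_eq) auto
      then have "(p \<circ> Transposition.transpose e k) ` insert e (blk l) = p ` insert e (blk l)"
        by (metis image_comp)
      ultimately show "h (p \<circ> Transposition.transpose e k) e = h p k"
        unfolding h_def by (simp only: comp_apply transpose_apply_first)
    qed simp
    finally show ?thesis .
  qed
  have eb: "e \<notin> blk l" using blk[OF l] by auto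
  have "(L + 1) * (\<Sum>p | p permutes V. h p e) = (\<Sum>k\<in>insert e (blk l). \<Sum>p | p permutes V. h p e)"
    using fin[OF l] eb card by simp
  also have "\<dots> = (\<Sum>k\<in>insert e (blk l). \<Sum>p | p permutes V. h p k)"
    by (intro sum.cong refl eq)
  also have "\<dots> = (\<Sum>p | p permutes V. \<Sum>k\<in>insert e (blk l). h p k)"
    by (rule sum.swap)
  also have "\<dots> \<le> (\<Sum>p | p permutes V. 8 * ln (card Y))"
  proof (rule sum_mono)
    fix p assume "p \<in> {p. p permutes V}"
    then have inj: "inj p" by (simp add: permutes_inj)
    \<comment> \<open>For fixed \<open>p\<close> the earlier players do not depend on
      \<open>k\<close>. So the sum moves inside the mean, where it runs over all elements of one set
      and \<open>sum_leak_le\<close> applies.\<close>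
    have "(\<Sum>k\<in>insert e (blk l). h p k) = mean (map (\<lambda>l. p ` blk l) [0..<l])
      (\<lambda>Bs. \<Sum>k\<in>insert e (blk l). leak (f Bs) (p ` insert e (blk l)) (p k))"
      unfolding h_def by (rule mean_sum[symmetric])
    also have "\<dots> = mean (map (\<lambda>l. p ` blk l) [0..<l])
      (\<lambda>Bs. \<Sum>x\<in>p ` insert e (blk l). leak (f Bs) (p ` insert e (blk l)) x)"
      by (subst sum.reindex[OF inj_on_subset[OF inj subset_UNIV]]) simp
    also have "\<dots> \<le> mean (map (\<lambda>l. p ` blk l) [0..<l]) (\<lambda>_. 8 * ln (card Y))"
      using fin[OF l] Y by (intro mean_mono sum_leak_le) (auto simp: f_def)
    also have "\<dots> = 8 * ln (card Y)"
      by (rule mean_const) (use fin l in auto)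
    finally show "(\<Sum>k\<in>insert e (blk l). h p k) \<le> 8 * ln (card Y)" .
  qed
  finally show ?thesis by (simp add: h_def f_def add.commute)
qed

text \<open>The chain rule, summed over all hidden placements \<open>p\<close>. The tangent at
  \<open>c\<close> makes the second law enter linearly, ready to be integrated over the
  coins.\<close>

lemma sum_permutations_mean_ln_le:
  fixes V :: "'b set"
  assumes V: "finite V" "e \<in> V" and blk: "\<And>l. l < t \<Longrightarrow> blk l \<subseteq> V - {e}"
    and disj: "\<And>l l'. l < t \<Longrightarrow> l' < t \<Longrightarrow> l \<noteq> l' \<Longrightarrow> blk l \<inter> blk l' = {}"
    and card: "\<And>l. card (blk l) = L" and Y: "finite Y" "\<And>i B q. F i B q \<in> Y"
    and G: "\<And>y. G y > 0" and c: "c > 0"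
  shows "(\<Sum>p | p permutes V. mean (map (\<lambda>l. p ` blk l) [0..<t]) (\<lambda>Bs. ln (G (drive F 0 q Bs))))
    \<le> (\<Sum>p | p permutes V. ln c - 1 +
        mean (map (\<lambda>l. insert (p e) (p ` blk l)) [0..<t]) (\<lambda>Bs. G (drive F 0 q Bs)) / c)
      + card {p. p permutes V} * (t * (8 * ln (card Y) / (L + 1)))"
proof -
  let ?P = "{p. p permutes V}"
  let ?D = "\<lambda>p l. mean (map (\<lambda>l. p ` blk l) [0..<l])
    (\<lambda>Bs. leak (\<lambda>B. F l B (drive F 0 q Bs)) (insert (p e) (p ` blk l)) (p e))"
  let ?Z = "\<lambda>p. mean (map (\<lambda>l. insert (p e) (p ` blk l)) [0..<t]) (\<lambda>Bs. G (drive F 0 q Bs))"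
  have fin: "finite (blk l')" if "l' < t" for l' using blk[OF that] V by (meson finite_Diff finite_subset)
  have eb: "e \<notin> blk l" if "l < t" for l using blk[OF that] by auto
  have "(\<Sum>p\<in>?P. mean (map (\<lambda>l. p ` blk l) [0..<t]) (\<lambda>Bs. ln (G (drive F 0 q Bs))))
      \<le> (\<Sum>p\<in>?P. (ln c - 1 + ?Z p / c) + (\<Sum>l<t. ?D p l))"
  proof (rule sum_mono)
    fix p assume "p \<in> ?P"
    then have inj: "inj p" by (simp add: permutes_inj)
    have S: "finite S \<and> p e \<notin> S" if "S \<in> set (map (\<lambda>l. p ` blk l) [0..<t])" for S
      using that fin eb inj by (auto simp: inj_eq)
    have "mean (map (\<lambda>l. p ` blk l) [0..<t]) (\<lambda>Bs. ln (G (drive F 0 q Bs)))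
        \<le> ln (?Z p) + (\<Sum>l<t. ?D p l)"
      using mean_ln_le[where Ss = "map (\<lambda>l. p ` blk l) [0..<t]" and x = "p e" and G = G
          and F = F and i = 0 and q = q] S G
      by (simp add: comp_def take_map)
    moreover have "?Z p > 0" using fin G by (intro mean_pos) auto
    then have "ln (?Z p) \<le> ln c - 1 + ?Z p / c" by (intro ln_le_tangent c)
    ultimately show "mean (map (\<lambda>l. p ` blk l) [0..<t]) (\<lambda>Bs. ln (G (drive F 0 q Bs)))
        \<le> (ln c - 1 + ?Z p / c) + (\<Sum>l<t. ?D p l)" by linarith
  qed
  also have "\<dots> = (\<Sum>p\<in>?P. ln c - 1 + ?Z p / c) + (\<Sum>l<t. \<Sum>p\<in>?P. ?D p l)"
    unfolding sum.distrib by (subst sum.swap) simp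
  also have "(\<Sum>l<t. \<Sum>p\<in>?P. ?D p l) \<le> (\<Sum>l<t. card ?P * (8 * ln (card Y)) / (L + 1))"
  proof (rule sum_mono)
    fix l assume "l \<in> {..<t}"
    then have "(L + 1) * (\<Sum>p\<in>?P. ?D p l) \<le> card ?P * (8 * ln (card Y))"
      using sum_permutations_mean_leak_le
          [where t = t and blk = blk and l = l and L = L and F = F and q = q, OF V blk disj card Y]
        by (simp add: add.commute)
    then show "(\<Sum>p\<in>?P. ?D p l) \<le> card ?P * (8 * ln (card Y)) / (L + 1)"
      by (simp add: pos_le_divide_eq mult.commute)
  qed
  finally show ?thesis by (simp add: mult.commute mult.left_commute add.commute)
qed

section \<open>Streams and entropies\<close>

text \<open>The empirical distribution is uniform on the support, so its Renyi entropy is the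
  logarithm of the support size.\<close>

lemma renyi_entropy_indicator:
  assumes "\<alpha> > 1" and A: "\<And>i. i \<in> {1..n} \<Longrightarrow> A i \<in> {0, 1}" and ne: "{i \<in> {1..n}. A i = 1} \<noteq> {}"
  shows "renyi_entropy \<alpha> n A = ln (card {i \<in> {1..n}. A i = 1})"
proof -
  let ?N = "real (card {i \<in> {1..n}. A i = 1})"
  have ln_id: "ln (x * (1 / x) powr \<alpha>) = (1 - \<alpha>) * ln x" if "x > 0" for x :: real
    using that by (simp add: ln_mult ln_powr ln_div algebra_simps)
  have N: "?N > 0" using ne by (simp add: card_gt_0_iff)
  have "(\<Sum>i=1..n. real_of_int \<bar>A i\<bar>) = (\<Sum>i=1..n. if A i = 1 then 1 else 0)"
    using A by (intro sum.cong) force+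
  also have "\<dots> = ?N" by (simp add: sum.If_cases Int_def)
  finally have S: "(\<Sum>i=1..n. real_of_int \<bar>A i\<bar>) = ?N" .
  have "(\<Sum>i=1..n. empirical n A i powr \<alpha>) = (\<Sum>i=1..n. if A i = 1 then (1 / ?N) powr \<alpha> else 0)"
    unfolding empirical_def S using A by (intro sum.cong) force+
  also have "\<dots> = ?N * (1 / ?N) powr \<alpha>" by (simp add: sum.If_cases Int_def)
  also have "ln \<dots> = (1 - \<alpha>) * ln ?N"
    by (rule ln_id[OF N])
  finally show ?thesis using assms(1) by (simp add: renyi_entropy_def)
qed

text \<open>A single coordinate of relative weight at least \<open>r / S\<close> already contributes
  \<open>(r / S) powr \<alpha>\<close> to the power sum.\<close>

lemma renyi_entropy_le:
  fixes r S :: real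
  assumes "\<alpha> > 1" "i \<in> {1..n}" "r > 0" "r \<le> real_of_int \<bar>A i\<bar>" "(\<Sum>j=1..n. real_of_int \<bar>A j\<bar>) \<le> S"
  shows "renyi_entropy \<alpha> n A \<le> \<alpha> / (\<alpha> - 1) * ln (S / r)"
proof -
  let ?S = "\<Sum>j=1..n. real_of_int \<bar>A j\<bar>"
  have "real_of_int \<bar>A i\<bar> \<le> ?S" using assms(2) by (intro member_le_sum) auto
  then have S0: "?S > 0" using assms by linarith
  have S1: "S > 0" using S0 assms by linarith
  have "r / S \<le> real_of_int \<bar>A i\<bar> / ?S" using assms S0 by (intro frac_le) auto
  then have "(r / S) powr \<alpha> \<le> empirical n A i powr \<alpha>"
    unfolding empirical_def using assms S1 by (intro powr_mono2) auto
  also have "\<dots> \<le> (\<Sum>i=1..n. empirical n A i powr \<alpha>)"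
    using assms(2) by (intro member_le_sum) auto
  finally have le: "(r / S) powr \<alpha> \<le> (\<Sum>i=1..n. empirical n A i powr \<alpha>)" .
  moreover have "(r / S) powr \<alpha> > 0" using assms S1 by simp
  ultimately have "ln ((r / S) powr \<alpha>) \<le> ln (\<Sum>i=1..n. empirical n A i powr \<alpha>)"
    by (meson ln_le_cancel_iff less_le_trans)
  moreover have "ln ((r / S) powr \<alpha>) = - (\<alpha> * ln (S / r))"
    using assms(3) S1 by (simp add: ln_powr ln_div algebra_simps)
  ultimately have "- (\<alpha> * ln (S / r)) \<le> ln (\<Sum>i=1..n. empirical n A i powr \<alpha>)" by simp
  then have "1 / (\<alpha> - 1) * - ln (\<Sum>i=1..n. empirical n A i powr \<alpha>) \<le> 1 / (\<alpha> - 1) * (\<alpha> * ln (S / r))"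
    using assms(1) by (intro mult_left_mono) auto
  moreover have "1 / (1 - \<alpha>) = - (1 / (\<alpha> - 1))" by (metis minus_diff_eq minus_divide_right)
  ultimately show ?thesis by (simp add: renyi_entropy_def)
qed

section \<open>Frequency vectors and blocks of updates\<close>

lemma frequency_vector_eq_sum_list:
  "frequency_vector \<sigma> i = (\<Sum>(j, v)\<leftarrow>\<sigma>. if j = i then v else 0)"
proof -
  have "fold (\<lambda>(i, v) A. A(i := A i + v)) \<sigma> A i = A i + (\<Sum>(j, v)\<leftarrow>\<sigma>. if j = i then v else 0)" for A
    by (induction \<sigma> arbitrary: A) (auto split: prod.splits)
  then show ?thesis by (simp add: frequency_vector_def)
qed

lemma frequency_vector_append:
  "frequency_vector (\<sigma> @ \<tau>) i = frequency_vector \<sigma> i + frequency_vector \<tau> i"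
  by (simp add: frequency_vector_eq_sum_list)

lemma frequency_vector_units:
  "distinct J \<Longrightarrow> frequency_vector (map (\<lambda>j. (j, 1)) J) i = of_bool (i \<in> set J)"
  by (induction J) (auto simp: frequency_vector_eq_sum_list)

lemma frequency_vector_replicate_0: "frequency_vector (replicate k (j, 0)) i = 0"
  by (induction k) (auto simp: frequency_vector_eq_sum_list)

lemma sum_abs_frequency_vector_le:
  "(\<Sum>i=1..n. \<bar>frequency_vector \<sigma> i\<bar>) \<le> (\<Sum>(j, v)\<leftarrow>\<sigma>. \<bar>v\<bar>)"
proof (induction \<sigma>)
  case Nil
  then show ?case by (simp add: frequency_vector_eq_sum_list)
next
  case (Cons u \<sigma>)
  obtain j v where u: "u = (j, v)" by fastforce
  have "(\<Sum>i=1..n. \<bar>frequency_vector (u # \<sigma>) i\<bar>)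
      \<le> (\<Sum>i=1..n. (if i = j then \<bar>v\<bar> else 0) + \<bar>frequency_vector \<sigma> i\<bar>)"
    by (intro sum_mono) (auto simp: frequency_vector_eq_sum_list u)
  also have "\<dots> \<le> \<bar>v\<bar> + (\<Sum>i=1..n. \<bar>frequency_vector \<sigma> i\<bar>)"
    by (simp add: sum.distrib sum.delta)
  finally show ?case using Cons.IH u by simp
qed

text \<open>The padding makes the length of a block independent of \<open>B\<close>: otherwise the position in the
  stream, which is not charged as space, would reveal \<open>card B\<close>.\<close>

definition block :: "nat \<Rightarrow> nat set \<Rightarrow> update list" where
  "block K B = map (\<lambda>j. (j, 1)) (sorted_list_of_set B) @ replicate (K - card B) (1, 0)"

lemma length_block: "card B \<le> K \<Longrightarrow> length (block K B) = K"
  by (simp add: block_def)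

lemma frequency_vector_block: "finite B \<Longrightarrow> frequency_vector (block K B) i = of_bool (i \<in> B)"
  by (simp add: block_def frequency_vector_append frequency_vector_units frequency_vector_replicate_0)

lemma length_concat_blocks:
  "(\<And>B. B \<in> set Bs \<Longrightarrow> card B \<le> K) \<Longrightarrow> length (concat (map (block K) Bs)) = K * length Bs"
  by (induction Bs) (auto simp: length_block)

lemma frequency_vector_concat_blocks:
  "(\<And>B. B \<in> set Bs \<Longrightarrow> finite B) \<Longrightarrow>
    frequency_vector (concat (map (block K) Bs)) i = length (filter (\<lambda>B. i \<in> B) Bs)"
proof (induction Bs)
  case Nil
  then show ?case by (simp add: frequency_vector_eq_sum_list)
qed (simp add: frequency_vector_append frequency_vector_block)

lemma sum_abs_concat_blocks_le:
  "(\<And>B. B \<in> set Bs \<Longrightarrow> card B \<le> K) \<Longrightarrow>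
    (\<Sum>(j, v)\<leftarrow>concat (map (block K) Bs). \<bar>v\<bar>) \<le> int (K * length Bs)"
proof (induction Bs)
  case (Cons B Bs)
  have "(\<Sum>(j, v)\<leftarrow>block K B. \<bar>v\<bar>) \<le> int K"
    using Cons.prems[of B] by (simp add: block_def comp_def sum_list_triv sum_list_replicate)
  moreover have "(\<Sum>(j, v)\<leftarrow>concat (map (block K) Bs). \<bar>v\<bar>) \<le> int (K * length Bs)"
    using Cons by simp
  ultimately show ?case by (simp add: distrib_left)
qed simp

lemma run_from_append:
  "run_from a k q (\<sigma> @ \<tau>) = run_from a (k + length \<sigma>) (run_from a k q \<sigma>) \<tau>"
  by (induction \<sigma> arbitrary: k q) auto

text \<open>Only the memory contents reached on admissible streams have length \<open>s\<close>; clipping makes the step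
  function range over \<open>2^s\<close> values for every argument.\<close>

definition clip :: "nat \<Rightarrow> bool list \<Rightarrow> bool list" where
  "clip s q = (if length q = s then q else replicate s False)"

definition block_step :: "stream_alg \<Rightarrow> nat \<Rightarrow> nat \<Rightarrow> nat \<Rightarrow> nat \<Rightarrow> nat set \<Rightarrow> bool list \<Rightarrow> bool list" where
  "block_step a s k K i B q = clip s (run_from a (k + K * i) q (block K B))"

lemma length_block_step: "length (block_step a s k K i B q) = s"
  by (simp add: block_step_def clip_def)

text \<open>The second assumption makes clipping idle along the whole run, and blocks of equal
  length \<open>K\<close> keep the position \<open>k + K * i\<close> right. So the chain is the
  actual algorithm.\<close>

lemma drive_block_step:
  assumes "\<And>B. B \<in> set Bs \<Longrightarrow> card B \<le> K"
    and "\<And>j. j \<le> K * length Bs \<Longrightarrow>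
      length (run_from a (k + K * i) q (take j (concat (map (block K) Bs)))) = s"
  shows "drive (block_step a s k K) i q Bs = run_from a (k + K * i) q (concat (map (block K) Bs))"
  using assms
proof (induction Bs arbitrary: i q)
  case (Cons B Bs)
  let ?q = "run_from a (k + K * i) q (block K B)"
  have lB: "length (block K B) = K" using Cons.prems(1) by (simp add: length_block)
  have "length ?q = s" using Cons.prems(2)[of K] lB by simp
  then have step: "block_step a s k K i B q = ?q" by (simp add: block_step_def clip_def)
  have "drive (block_step a s k K) (Suc i) ?q Bs = run_from a (k + K * Suc i) ?q (concat (map (block K) Bs))"
  proof (rule Cons.IH)
    fix j assume "j \<le> K * length Bs"
    then show "length (run_from a (k + K * Suc i) ?q (take j (concat (map (block K) Bs)))) = s"
      using Cons.prems(2)[of "K + j"] lB by (simp add: run_from_append add_ac)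
  qed (use Cons.prems(1) in simp)
  then show ?case using step lB by (simp add: run_from_append add_ac)
qed simp

text \<open>Exponential moment for a Chernoff bound on the number of players inserting \<open>x\<close>.\<close>

lemma mean_half_power_count:
  assumes "\<And>S. S \<in> set Ss \<Longrightarrow> finite S \<and> x \<notin> S"
  shows "mean (map (insert x) Ss) (\<lambda>Bs. (1 / 2) ^ length (filter (\<lambda>B. x \<in> B) Bs)) = (3 / 4) ^ length Ss"
  using assms
proof (induction Ss)
  case (Cons S Ss)
  have S: "finite S" "x \<notin> S" using Cons.prems by auto
  let ?w = "\<lambda>B. if x \<in> B then 1 / 2 else 1 :: real"
  have "(1 / 2 :: real) ^ length (filter (\<lambda>B. x \<in> B) (B # Bs))
      = ?w B * (1 / 2) ^ length (filter (\<lambda>B. x \<in> B) Bs)" for B Bs by simp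
  then have "mean (map (insert x) (S # Ss)) (\<lambda>Bs. (1 / 2) ^ length (filter (\<lambda>B. x \<in> B) Bs))
      = subset_mean (insert x S) (\<lambda>B. (3 / 4) ^ length Ss * ?w B)"
    using Cons by (simp only: list.map mean.simps mean_cmult) (simp add: mult.commute)
  also have "\<dots> = (3 / 4) ^ length Ss * subset_mean (insert x S) ?w"
    by (rule subset_mean_cmult)
  also have "subset_mean (insert x S) ?w = 3 / 4"
  proof -
    have "(\<Sum>B\<in>insert x ` Pow S. ?w B) = 2 ^ card S / 2"
      using S by (subst sum.reindex) (auto intro!: inj_onI simp: card_Pow)
    moreover have "(\<Sum>B\<in>Pow S. ?w B) = (\<Sum>B\<in>Pow S. 1)" using S by (intro sum.cong) auto
    then have "(\<Sum>B\<in>Pow S. ?w B) = 2 ^ card S" using S by (simp add: card_Pow)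
    moreover have "Pow S \<inter> insert x ` Pow S = {}" using S by auto
    then have "(\<Sum>B\<in>Pow (insert x S). ?w B) = (\<Sum>B\<in>Pow S. ?w B) + (\<Sum>B\<in>insert x ` Pow S. ?w B)"
      using S unfolding Pow_insert by (intro sum.union_disjoint) auto
    ultimately show ?thesis
      using S by (simp only: subset_mean_def) simp
  qed
  finally show ?case by simp
qed simp

lemma integrable_mean:
  fixes X :: "'a \<Rightarrow> 'b set list \<Rightarrow> real"
  assumes "\<And>Bs. integrable M (\<lambda>a. X a Bs)"
  shows "integrable M (\<lambda>a. mean Ss (X a))"
  using assms
proof (induction Ss arbitrary: X)
  case (Cons S Ss)
  show ?case unfolding mean.simps subset_mean_def
    by (intro integrable_divide Bochner_Integration.integrable_sum Cons.IH Cons.prems)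
qed simp

text \<open>\<open>mean\<close> is built from finite sums, so the expectation over the coins passes
  through it.\<close>

lemma integral_mean:
  fixes X :: "'a \<Rightarrow> 'b set list \<Rightarrow> real"
  assumes "\<And>Bs. integrable M (\<lambda>a. X a Bs)"
  shows "(\<integral>a. mean Ss (X a) \<partial>M) = mean Ss (\<lambda>Bs. \<integral>a. X a Bs \<partial>M)"
  using assms
proof (induction Ss arbitrary: X)
  case (Cons S Ss)
  have "(\<integral>a. mean (S # Ss) (X a) \<partial>M) = (\<Sum>B\<in>Pow S. \<integral>a. mean Ss (\<lambda>Bs. X a (B # Bs)) \<partial>M) / 2 ^ card S"
    unfolding mean.simps subset_mean_def
    by (subst integral_divide_zero, subst Bochner_Integration.integral_sum)
      (auto intro!: integrable_mean Cons.prems)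
  then show ?case using Cons.IH[OF Cons.prems] by (simp add: subset_mean_def)
qed simp

section \<open>The hard distributions\<close>

lemma card_lists_bool: "card {q :: bool list. length q = s} = 2 ^ s"
  using card_lists_length_eq[of "UNIV :: bool set" s] by simp

lemma finite_lists_bool: "finite {q :: bool list. length q = s}"
  using finite_lists_length_eq[of "UNIV :: bool set" s] by simp

text \<open>By \<open>gap\<close>, comparing the answer with ln (n / 2) separates disjoint inputs
  from inputs with a coordinate of weight at least \<open>u\<close>. This forces a constant
  divergence between the two laws, while \<open>s\<close> bits of memory allow at most 8 t s / K,
  with t = 4 u players.\<close>

lemma block_size_le_space:
  fixes \<alpha> c :: real and n m s u K :: nat
  assumes approx: "approximates_renyi P c \<alpha> n m M" and bits: "uses_bits P n m M s"
    and M: "M \<ge> 1" and m: "m \<ge> n" and \<alpha>: "\<alpha> > 1" and c: "c \<ge> 0"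
    and u: "u \<ge> 8" and K: "K \<ge> 1" and tK: "2 * (4 * u) * K \<le> n"
    and gap: "c * (\<alpha> / (\<alpha> - 1) * ln (n / u)) < ln (n / 2)"
  shows "real K \<le> 80 * (4 * u) * s"
proof -
  \<comment> \<open>The secret is inserted 2 u times on average, hence at least \<open>u\<close>
    times with high probability.\<close>
  define t where "t = 4 * u"
  \<comment> \<open>A player's set together with the secret has \<open>K\<close> elements, the
    length of a block.\<close>
  define L where "L = K - 1"
  define V where "V = {1..t * L + 1}"
  define blk where "blk = (\<lambda>l. {2 + l * L..<2 + Suc l * L})"
  \<comment> \<open>The filler coordinates and the blocks take exactly \<open>n\<close> updates, and
    the fillers number at least n / 2.\<close>
  define n' where "n' = n - t * K"
  define J where "J = [t * L + 2..<t * L + 2 + n']"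
  define tail where "tail = replicate (m - n) (1::nat, 0::int)"
  define body where "body = (\<lambda>Bs. concat (map (block K) Bs))"
  define \<sigma> where "\<sigma> = (\<lambda>Bs. map (\<lambda>j. (j, 1)) J @ body Bs @ tail)"
  define \<theta> where "\<theta> = ln (real n / 2)"
  define X :: "stream_alg \<Rightarrow> nat set list \<Rightarrow> real"
    where "X = (\<lambda>a Bs. of_bool (\<theta> \<le> answer a (run a (\<sigma> Bs))))"
  \<comment> \<open>\<open>S p\<close> lists the players' sets under the first law and
    \<open>T p\<close> those under the second, where \<open>p 1\<close> is the secret.\<close>
  define S where "S = (\<lambda>p :: nat \<Rightarrow> nat. map (\<lambda>l. p ` blk l) [0..<t])"
  define T where "T = (\<lambda>p :: nat \<Rightarrow> nat. map (\<lambda>l. insert (p 1) (p ` blk l)) [0..<t])"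
  define valid where "valid = (\<lambda>Bs :: nat set list. length Bs = t \<and> (\<forall>B\<in>set Bs. B \<subseteq> V \<and> card B \<le> K))"
  define N where "N = real (card {p. p permutes V})"
  have t: "t \<ge> 1" using u by (simp add: t_def)
  have tK': "2 * (t * K) \<le> n" using tK by (simp add: t_def mult.assoc)
  have KL: "K = L + 1" using K by (simp add: L_def)
  have n_split: "n' + t * K = n" using tK' by (simp add: n'_def)
  have n'2: "real n / 2 \<le> n'" using tK' n_split by linarith
  have tL: "t * K = t * L + t" by (simp add: KL)
  have J_le: "j \<in> {1..n} \<and> j \<notin> V" if "j \<in> set J" for j
    using that n_split tL t by (auto simp: J_def V_def)
  have V_le: "V \<subseteq> {1..n}" using n_split tL t by (auto simp: V_def)
  have distinct_J: "distinct J" by (simp only: J_def distinct_upt)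
  have lenJ: "length J = n'" by (simp only: J_def length_upt add_diff_cancel_left')
  have n0: "n > 0" using tK' t K by (cases n) auto

  have blk: "blk l \<subseteq> V - {1}" if "l < t" for l
  proof -
    have "Suc l * L \<le> t * L" using that by (intro mult_le_mono1) simp
    then show ?thesis by (auto simp: blk_def V_def)
  qed
  have disj: "blk l \<inter> blk l' = {}" if "l \<noteq> l'" for l l'
  proof -
    have "blk l \<inter> blk l' = {}" if "l < l'" for l l'
    proof -
      have "Suc l * L \<le> l' * L" using that by (intro mult_le_mono1) simp
      then show ?thesis by (auto simp: blk_def)
    qed
    then show ?thesis using that by (metis Int_commute linorder_neqE_nat)
  qed
  have card_blk: "card (blk l) = L" for l by (simp add: blk_def)
  have finV: "finite V" by (simp add: V_def)
  have one_V: "1 \<in> V" by (simp add: V_def)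
  have N0: "N > 0"
    unfolding N_def using finV by (simp add: card_permutations[OF refl])

  have valid_finite: "finite B" "card B \<le> K" if "valid Bs" "B \<in> set Bs" for B Bs
    using that finV by (auto simp: valid_def intro: finite_subset)
  have T_valid: "valid Bs" if p: "p permutes V" and Bs: "list_all2 (\<subseteq>) Bs (T p)" for p Bs
    unfolding valid_def
  proof (intro conjI ballI)
    show "length Bs = t" using list_all2_lengthD[OF Bs] by (simp add: T_def)
    fix B assume "B \<in> set Bs"
    then obtain l where l: "l < t" "B \<subseteq> insert (p 1) (p ` blk l)"
      using Bs by (auto simp: T_def list_all2_conv_all_nth in_set_conv_nth)
    have "insert (p 1) (p ` blk l) = p ` insert 1 (blk l)" by simp
    also have "\<dots> \<subseteq> p ` V" using blk[OF l(1)] one_V by (intro image_mono) auto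
    also have "\<dots> = V" using p by (simp add: permutes_image)
    finally show "B \<subseteq> V" using l by blast
    have fin: "finite (blk l)" by (simp add: blk_def)
    have "card B \<le> card (p ` insert 1 (blk l))" using l fin by (intro card_mono) auto
    also have "\<dots> \<le> card (insert 1 (blk l))" using fin by (intro card_image_le) simp
    also have "\<dots> \<le> K" using card_insert_le_m1[of K "blk l" 1] K card_blk[of l] by (simp add: L_def)
    finally show "card B \<le> K" .
  qed
  have S_T: "list_all2 (\<subseteq>) Bs (T p)" if "list_all2 (\<subseteq>) Bs (S p)" for p Bs
    using that by (fastforce simp: S_def T_def list_all2_conv_all_nth)
  have len_body: "length (body Bs) = t * K" if "valid Bs" for Bs
    unfolding body_def using that valid_finite[OF that]
    by (subst length_concat_blocks) (auto simp: valid_def)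
  have \<sigma>_stream: "\<sigma> Bs \<in> update_streams n m M" if "valid Bs" for Bs
  proof -
    have "length (\<sigma> Bs) = m"
      using len_body[OF that] n_split m by (simp add: \<sigma>_def lenJ tail_def)
    moreover have "i \<in> {1..n} \<and> \<bar>v\<bar> \<le> M" if iv: "(i, v) \<in> set (\<sigma> Bs)" for i v
    proof -
      have "i \<in> {1..n} \<and> \<bar>v\<bar> \<le> M" if "(i, v) \<in> set (block K B)" "B \<in> set Bs" for B
      proof -
        have "B \<subseteq> {1..n}" using \<open>valid Bs\<close> that V_le by (auto simp: valid_def)
        then show ?thesis
          using that M n0 valid_finite[OF \<open>valid Bs\<close> that(2)] by (auto simp: block_def)
      qed
      then show ?thesis
        using iv J_le M n0 by (auto simp: \<sigma>_def tail_def body_def)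
    qed
    ultimately show ?thesis by (auto simp: update_streams_def)
  qed
  have freq: "frequency_vector (\<sigma> Bs) i = of_bool (i \<in> set J) + length (filter (\<lambda>B. i \<in> B) Bs)"
    if "valid Bs" for Bs i
    using valid_finite[OF that]
    by (simp add: \<sigma>_def body_def tail_def frequency_vector_append frequency_vector_units
        frequency_vector_replicate_0 frequency_vector_concat_blocks distinct_J)
  have freq_nz: "frequency_vector (\<sigma> Bs) \<noteq> (\<lambda>_. 0)" if "valid Bs" for Bs
  proof -
    have "n' > 0" using n'2 n0 by (cases n') auto
    then have "t * L + 2 \<in> set J" unfolding J_def set_upt atLeastLessThan_iff by linarith
    then have "frequency_vector (\<sigma> Bs) (t * L + 2) \<noteq> 0" using freq[OF that] by simp
    then show ?thesis by metis
  qed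
  have ok: "measure_pmf.prob P {a. mult_approx c (renyi_entropy \<alpha> n (frequency_vector (\<sigma> Bs)))
      (answer a (run a (\<sigma> Bs)))} \<ge> 2 / 3" if "valid Bs" for Bs
    using approx \<sigma>_stream[OF that] freq_nz[OF that] unfolding approximates_renyi_def by blast
  have EX: "(\<integral>a. X a Bs \<partial>measure_pmf P) = measure_pmf.prob P {a. \<theta> \<le> answer a (run a (\<sigma> Bs))}" for Bs
  proof -
    have "(\<lambda>a. X a Bs) = indicator {a. \<theta> \<le> answer a (run a (\<sigma> Bs))}"
      by (auto simp: X_def indicator_def)
    then show ?thesis by simp
  qed
  have intX: "integrable (measure_pmf P) (\<lambda>a. X a Bs)" for Bs
    by (rule measure_pmf.integrable_const_bound[where B = 1]) (auto simp: X_def)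

  \<comment> \<open>The images of the blocks are disjoint, so all frequencies are 0 or 1, and the
    fillers alone give entropy at least \<open>\<theta>\<close>. A correct answer is never below the
    entropy.\<close>
  have disjoint_high: "2 / 3 \<le> (\<integral>a. X a Bs \<partial>measure_pmf P)"
    if p: "p permutes V" and Bs: "list_all2 (\<subseteq>) Bs (S p)" for p Bs
  proof -
    have v: "valid Bs" by (rule T_valid[OF p S_T[OF Bs]])
    define A where "A = frequency_vector (\<sigma> Bs)"
    have inj: "inj p" using p by (simp add: permutes_inj)
    have len: "length Bs = t" using v by (simp add: valid_def)
    have sub: "Bs ! l \<subseteq> p ` blk l" if "l < t" for l
      using list_all2_nthD[OF Bs, of l] that len by (simp add: S_def)
    have count_le: "length (filter (\<lambda>B. i \<in> B) Bs) \<le> 1" for i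
    proof -
      have "l = l'" if "l < t" "l' < t" "i \<in> Bs ! l" "i \<in> Bs ! l'" for l l'
      proof -
        have "i \<in> p ` blk l \<inter> p ` blk l'" using sub that by blast
        then have "blk l \<inter> blk l' \<noteq> {}" using inj by (auto simp: image_Int[symmetric])
        then show "l = l'" using disj by blast
      qed
      then have "card {l. l < length Bs \<and> i \<in> Bs ! l} \<le> 1"
        by (subst card_le_Suc0_iff_eq[unfolded One_nat_def[symmetric]]) (auto simp: len)
      then show ?thesis by (simp add: length_filter_conv_card)
    qed
    have A01: "A i \<in> {0, 1}" if "i \<in> {1..n}" for i
    proof (cases "i \<in> set J")
      case True
      then have "i \<notin> B" if "B \<in> set Bs" for B using J_le v that by (auto simp: valid_def)
      then have "filter (\<lambda>B. i \<in> B) Bs = []" by (simp add: filter_empty_conv)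
      then show ?thesis using True by (simp add: A_def freq[OF v])
    next
      case False
      moreover have "length (filter (\<lambda>B. i \<in> B) Bs) = 0 \<or> length (filter (\<lambda>B. i \<in> B) Bs) = 1"
        using count_le[of i] by linarith
      ultimately show ?thesis by (auto simp: A_def freq[OF v])
    qed
    have "set J \<subseteq> {i \<in> {1..n}. A i = 1}"
    proof
      fix i assume i: "i \<in> set J"
      have "A i \<noteq> 0" using i by (simp add: A_def freq[OF v])
      then show "i \<in> {i \<in> {1..n}. A i = 1}" using A01 J_le[OF i] by auto
    qed
    then have "card (set J) \<le> card {i \<in> {1..n}. A i = 1}" by (intro card_mono) auto
    then have n'_le: "n' \<le> card {i \<in> {1..n}. A i = 1}" using distinct_J lenJ by (simp add: distinct_card)
    moreover have n'0: "real n / 2 > 0" using n0 by simp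
    ultimately have pos: "card {i \<in> {1..n}. A i = 1} > 0" using n'2 by linarith
    then have "renyi_entropy \<alpha> n A = ln (card {i \<in> {1..n}. A i = 1})"
      using A01 by (intro renyi_entropy_indicator[OF \<alpha>]) (auto simp: card_gt_0_iff)
    also have "\<dots> \<ge> \<theta>"
      unfolding \<theta>_def using n'_le n'2 n'0 pos by (subst ln_le_cancel_iff) linarith+
    finally have "{a. mult_approx c (renyi_entropy \<alpha> n A) (answer a (run a (\<sigma> Bs)))}
        \<subseteq> {a. \<theta> \<le> answer a (run a (\<sigma> Bs))}"
      by (auto simp: mult_approx_def)
    then have "measure_pmf.prob P {a. mult_approx c (renyi_entropy \<alpha> n A) (answer a (run a (\<sigma> Bs)))}
        \<le> measure_pmf.prob P {a. \<theta> \<le> answer a (run a (\<sigma> Bs))}"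
      by (intro measure_pmf.finite_measure_mono) auto
    then show ?thesis using ok[OF v] by (simp add: EX A_def)
  qed

  \<comment> \<open>If the secret occurs at least \<open>u\<close> times, a correct answer stays
    below \<open>\<theta>\<close>. Otherwise the exponential term is at least 1 and the bound is
    trivial.\<close>
  have heavy_low: "(\<integral>a. X a Bs \<partial>measure_pmf P)
      \<le> 1 / 3 + 2 ^ u * (1 / 2) ^ length (filter (\<lambda>B. p 1 \<in> B) Bs)"
    if p: "p permutes V" and Bs: "list_all2 (\<subseteq>) Bs (T p)" for p Bs
  proof (cases "length (filter (\<lambda>B. p 1 \<in> B) Bs) \<ge> u")
    case True
    have v: "valid Bs" by (rule T_valid[OF p Bs])
    define A where "A = frequency_vector (\<sigma> Bs)"
    have p1: "p 1 \<in> {1..n}" using p one_V V_le by (meson permutes_in_image subsetD)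
    have Ap: "real u \<le> real_of_int \<bar>A (p 1)\<bar>" using True by (simp add: A_def freq[OF v])
    have "(\<Sum>(j, v)\<leftarrow>body Bs. \<bar>v\<bar>) \<le> int (K * length Bs)"
      unfolding body_def by (rule sum_abs_concat_blocks_le) (rule valid_finite[OF v])
    then have "(\<Sum>(j, v)\<leftarrow>\<sigma> Bs. \<bar>v\<bar>) \<le> int n' + int (K * length Bs)"
      by (simp add: \<sigma>_def tail_def comp_def sum_list_triv sum_list_replicate lenJ)
    also have "\<dots> = n" using v n_split by (simp add: valid_def mult.commute flip: of_nat_mult of_nat_add)
    finally have "(\<Sum>j=1..n. \<bar>A j\<bar>) \<le> int n"
      using sum_abs_frequency_vector_le[of "\<sigma> Bs" n] by (simp add: A_def)
    then have "real_of_int (\<Sum>j=1..n. \<bar>A j\<bar>) \<le> n" by linarith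
    then have "(\<Sum>j=1..n. real_of_int \<bar>A j\<bar>) \<le> n" by (simp only: of_int_sum)
    then have "renyi_entropy \<alpha> n A \<le> \<alpha> / (\<alpha> - 1) * ln (n / u)"
      using u by (intro renyi_entropy_le[OF \<alpha> p1, where A = A] Ap) auto
    then have "c * renyi_entropy \<alpha> n A \<le> c * (\<alpha> / (\<alpha> - 1) * ln (n / u))"
      by (intro mult_left_mono c)
    also have "\<dots> < \<theta>" using gap by (simp add: \<theta>_def)
    finally have "{a. mult_approx c (renyi_entropy \<alpha> n A) (answer a (run a (\<sigma> Bs)))}
        \<subseteq> UNIV - {a. \<theta> \<le> answer a (run a (\<sigma> Bs))}"
      by (auto simp: mult_approx_def)
    then have "measure_pmf.prob P {a. mult_approx c (renyi_entropy \<alpha> n A) (answer a (run a (\<sigma> Bs)))}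
        \<le> measure_pmf.prob P (UNIV - {a. \<theta> \<le> answer a (run a (\<sigma> Bs))})"
      by (intro measure_pmf.finite_measure_mono) auto
    also have "\<dots> = 1 - (\<integral>a. X a Bs \<partial>measure_pmf P)"
      unfolding EX using measure_pmf.prob_compl[of "{a. \<theta> \<le> answer a (run a (\<sigma> Bs))}" P] by simp
    finally have "(\<integral>a. X a Bs \<partial>measure_pmf P) \<le> 1 / 3" using ok[OF v] by (simp add: A_def)
    moreover have "0 \<le> 2 ^ u * (1 / 2 :: real) ^ length (filter (\<lambda>B. p 1 \<in> B) Bs)" by simp
    ultimately show ?thesis by linarith
  next
    case False
    have "(1::real) = 2 ^ u * (1 / 2) ^ u" by (simp add: power_mult_distrib[symmetric])
    also have "\<dots> \<le> 2 ^ u * (1 / 2) ^ length (filter (\<lambda>B. p 1 \<in> B) Bs)"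
      using False by (intro mult_left_mono power_decreasing) auto
    finally show ?thesis using measure_pmf.prob_le_1[of P "{a. \<theta> \<le> answer a (run a (\<sigma> Bs))}"]
      unfolding EX by linarith
  qed

  \<comment> \<open>The test function is 1 + Y with \<open>Y\<close> the outcome of the threshold
    test; as \<open>Y\<close> is 0 or 1, its logarithm is \<open>ln 2 * Y\<close>. The tangent point
    4/3 is the approximate mean of 1 + Y under the second law.\<close>
  have step: "(\<Sum>p | p permutes V. ln 2 * mean (S p) (X a))
      \<le> (\<Sum>p | p permutes V. ln (4 / 3) - 1 + (1 + mean (T p) (X a)) / (4 / 3)) + N * (t * (8 * s / K))"
    if a: "a \<in> set_pmf P" for a
  proof -
    define F where "F = block_step a s n' K"
    \<comment> \<open>The fillers come first and do not depend on \<open>p\<close>, so the chain has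
      the same initial memory for every placement.\<close>
    define q0 where "q0 = run_from a 0 (init_memory a) (map (\<lambda>j. (j, 1)) J)"
    define Y :: "bool list \<Rightarrow> real"
      where "Y = (\<lambda>q. of_bool (\<theta> \<le> answer a (run_from a (n' + t * K) q tail)))"
    have Y_X: "Y (drive F 0 q0 Bs) = X a Bs" if v: "valid Bs" for Bs
    proof -
      have "drive F 0 q0 Bs = run_from a (n' + K * 0) q0 (body Bs)"
        unfolding F_def body_def
      proof (rule drive_block_step)
        fix j assume "j \<le> K * length Bs"
        then have j: "j \<le> t * K" using v by (simp add: valid_def mult.commute)
        have "take (n' + j) (\<sigma> Bs) = map (\<lambda>j. (j, 1)) J @ take j (body Bs)"
          using j len_body[OF v] by (simp add: \<sigma>_def lenJ)
        moreover have "n' + j \<le> m" using j n_split m by linarith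
        then have "length (run a (take (n' + j) (\<sigma> Bs))) = s"
          using bits a \<sigma>_stream[OF v] unfolding uses_bits_def by blast
        ultimately show "length (run_from a (n' + K * 0) q0 (take j (concat (map (block K) Bs)))) = s"
          by (simp add: run_def run_from_append q0_def lenJ body_def)
      qed (use valid_finite[OF v] in auto)
      then show ?thesis
        using len_body[OF v]
        by (simp add: X_def Y_def \<sigma>_def run_def run_from_append q0_def lenJ)
    qed
    have ln_G: "ln (1 + Y q) = ln 2 * Y q" for q by (simp add: Y_def)
    have S_eq: "mean (S p) (\<lambda>Bs. ln (1 + Y (drive F 0 q0 Bs))) = ln 2 * mean (S p) (X a)"
      if "p permutes V" for p
      unfolding ln_G mean_cmult[symmetric]
      using Y_X[OF T_valid[OF that S_T]] by (intro antisym mean_mono) auto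
    have T_eq: "mean (T p) (\<lambda>Bs. 1 + Y (drive F 0 q0 Bs)) = 1 + mean (T p) (X a)"
      if "p permutes V" for p
    proof -
      have "mean (T p) (\<lambda>Bs. 1 + Y (drive F 0 q0 Bs)) = mean (T p) (\<lambda>_. 1) + mean (T p) (X a)"
        unfolding mean_add[symmetric] using Y_X[OF T_valid[OF that]] by (intro antisym mean_mono) auto
      also have "mean (T p) (\<lambda>_. 1) = 1" by (rule mean_const) (auto simp: T_def blk_def)
      finally show ?thesis .
    qed
    have "(\<Sum>p | p permutes V. ln 2 * mean (S p) (X a))
        = (\<Sum>p | p permutes V. mean (S p) (\<lambda>Bs. ln (1 + Y (drive F 0 q0 Bs))))"
      using S_eq by simp
    also have "\<dots> \<le> (\<Sum>p | p permutes V. ln (4 / 3) - 1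
          + mean (T p) (\<lambda>Bs. 1 + Y (drive F 0 q0 Bs)) / (4 / 3))
        + N * (t * (8 * ln (card {q :: bool list. length q = s}) / (real L + 1)))"
      unfolding S_def T_def N_def
    proof (rule sum_permutations_mean_ln_le[where G = "\<lambda>q. 1 + Y q"])
      show "blk l \<inter> blk l' = {}" if "l \<noteq> l'" for l l' by (rule disj[OF that])
    qed (use finV one_V blk card_blk finite_lists_bool in \<open>auto simp: F_def length_block_step Y_def\<close>)
    also have "(\<Sum>p | p permutes V. ln (4 / 3) - 1
          + mean (T p) (\<lambda>Bs. 1 + Y (drive F 0 q0 Bs)) / (4 / 3))
        = (\<Sum>p | p permutes V. ln (4 / 3) - 1 + (1 + mean (T p) (X a)) / (4 / 3))"
      using T_eq by simp
    also have "N * (t * (8 * ln (card {q :: bool list. length q = s}) / (real L + 1))) \<le> N * (t * (8 * s / K))"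
    proof -
      have "ln (card {q :: bool list. length q = s}) = s * ln 2"
        by (simp add: card_lists_bool ln_realpow)
      also have "\<dots> \<le> real s * 1" using ln_2_less_1 by (intro mult_left_mono) auto
      finally have "ln (card {q :: bool list. length q = s}) \<le> s" by simp
      moreover have rK: "real K = real L + 1" by (simp add: KL)
      ultimately show ?thesis
        unfolding rK using N0 by (intro mult_left_mono divide_right_mono) auto
    qed
    finally show ?thesis by simp
  qed

  let ?E = "\<lambda>f. \<integral>a. f a \<partial>measure_pmf P"
  have int_mean: "integrable (measure_pmf P) (\<lambda>a. mean Ss (X a))" for Ss
    by (rule integrable_mean[OF intX])
  \<comment> \<open>Both sides of \<open>step\<close> are affine in the means of \<open>X a\<close>,
    so it integrates over the coins term by term.\<close>
  have "(\<Sum>p | p permutes V. ln 2 * ?E (\<lambda>a. mean (S p) (X a)))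
      = ?E (\<lambda>a. \<Sum>p | p permutes V. ln 2 * mean (S p) (X a))"
    using int_mean by (simp add: Bochner_Integration.integral_sum)
  also have "\<dots> \<le> ?E (\<lambda>a. (\<Sum>p | p permutes V. ln (4 / 3) - 1 + (1 + mean (T p) (X a)) / (4 / 3))
      + N * (t * (8 * s / K)))"
    using step int_mean by (intro integral_mono_AE) (auto simp: AE_measure_pmf_iff)
  also have "\<dots> = (\<Sum>p | p permutes V. ln (4 / 3) - 1 + (1 + ?E (\<lambda>a. mean (T p) (X a))) / (4 / 3))
      + N * (t * (8 * s / K))"
    using int_mean by (simp add: Bochner_Integration.integral_sum)
  finally have main: "(\<Sum>p | p permutes V. ln 2 * ?E (\<lambda>a. mean (S p) (X a)))
      \<le> (\<Sum>p | p permutes V. ln (4 / 3) - 1 + (1 + ?E (\<lambda>a. mean (T p) (X a))) / (4 / 3))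
        + N * (t * (8 * s / K))" .

  \<comment> \<open>The Chernoff error: 2^u times (3/4)^(4 u) is (81/128)^u.\<close>
  define \<eta> :: real where "\<eta> = (81 / 128) ^ u"
  have ES: "2 / 3 \<le> ?E (\<lambda>a. mean (S p) (X a))" if p: "p permutes V" for p
  proof -
    have "2 / 3 = mean (S p) (\<lambda>_. 2 / 3)" by (rule mean_const[symmetric]) (auto simp: S_def blk_def)
    also have "\<dots> \<le> mean (S p) (\<lambda>Bs. ?E (\<lambda>a. X a Bs))" by (rule mean_mono) (rule disjoint_high[OF p])
    finally show ?thesis by (simp add: integral_mean[OF intX])
  qed
  have ET: "?E (\<lambda>a. mean (T p) (X a)) \<le> 1 / 3 + \<eta>" if p: "p permutes V" for p
  proof -
    have inj: "inj p" using p by (simp add: permutes_inj)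
    have T_S: "T p = map (insert (p 1)) (S p)" by (simp add: S_def T_def)
    have "?E (\<lambda>a. mean (T p) (X a)) = mean (T p) (\<lambda>Bs. ?E (\<lambda>a. X a Bs))"
      by (rule integral_mean[OF intX])
    also have "\<dots> \<le> mean (T p) (\<lambda>Bs. 1 / 3 + 2 ^ u * (1 / 2) ^ length (filter (\<lambda>B. p 1 \<in> B) Bs))"
      by (rule mean_mono) (rule heavy_low[OF p])
    also have "\<dots> = mean (T p) (\<lambda>_. 1 / 3) + 2 ^ u * mean (T p) (\<lambda>Bs. (1 / 2) ^ length (filter (\<lambda>B. p 1 \<in> B) Bs))"
      by (simp only: mean_add mean_cmult)
    also have "mean (T p) (\<lambda>_. 1 / 3) = 1 / 3" by (rule mean_const) (auto simp: T_def blk_def)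
    also have "mean (T p) (\<lambda>Bs. (1 / 2) ^ length (filter (\<lambda>B. p 1 \<in> B) Bs)) = (3 / 4) ^ length (S p)"
      unfolding T_S
    proof (rule mean_half_power_count)
      fix B assume "B \<in> set (S p)"
      then obtain l where "l < t" "B = p ` blk l" by (auto simp: S_def)
      then show "finite B \<and> p 1 \<notin> B" using blk[of l] inj by (auto simp: inj_image_mem_iff blk_def)
    qed
    also have "2 ^ u * (3 / 4) ^ length (S p) = \<eta>"
    proof -
      have "(3 / 4 :: real) ^ length (S p) = ((3 / 4) ^ 4) ^ u" by (simp add: S_def t_def power_mult)
      then show ?thesis by (simp add: \<eta>_def power_mult_distrib[symmetric] power_numeral_reduce)
    qed
    finally show ?thesis .
  qed
  have "\<eta> \<le> (81 / 128) ^ 8" unfolding \<eta>_def using u by (intro power_decreasing) auto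
  then have \<eta>: "\<eta> \<le> 3 / 100" by (simp add: power_numeral_reduce)
  have "N * (ln 2 * (2 / 3)) \<le> (\<Sum>p | p permutes V. ln 2 * ?E (\<lambda>a. mean (S p) (X a)))"
  proof -
    have "N * (ln 2 * (2 / 3)) = (\<Sum>p | p permutes V. ln 2 * (2 / 3))" by (simp add: N_def)
    also have "\<dots> \<le> (\<Sum>p | p permutes V. ln 2 * ?E (\<lambda>a. mean (S p) (X a)))"
      using ES by (intro sum_mono mult_left_mono) auto
    finally show ?thesis .
  qed
  also note main
  also have "(\<Sum>p | p permutes V. ln (4 / 3) - 1 + (1 + ?E (\<lambda>a. mean (T p) (X a))) / (4 / 3))
      \<le> (\<Sum>p | p permutes V. ln (4 / 3) + 3 / 4 * \<eta>)"
  proof (rule sum_mono)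
    fix p assume "p \<in> {p. p permutes V}"
    then show "ln (4 / 3) - 1 + (1 + ?E (\<lambda>a. mean (T p) (X a))) / (4 / 3) \<le> ln (4 / 3) + 3 / 4 * \<eta>"
      using ET[of p] by (simp add: field_simps)
  qed
  also have "\<dots> + N * (t * (8 * s / K)) = N * (ln (4 / 3) + 3 / 4 * \<eta> + t * (8 * s / K))"
    by (simp add: N_def algebra_simps)
  finally have "ln 2 * (2 / 3) \<le> ln (4 / 3) + 3 / 4 * \<eta> + t * (8 * s / K)"
    using N0 by (simp only: mult_le_cancel_left_pos)
  \<comment> \<open>The difference equals - ln (16 / 27) / 3. Subtracting 3/4 of 3/100 from 11/81
    still leaves more than 1/10.\<close>
  moreover have "ln 2 * (2 / 3) - ln (4 / 3) \<ge> (11 / 81 :: real)"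
  proof -
    have "ln (16 / 27) \<le> (16 / 27 - 1 :: real)" by (rule ln_le_minus_one) simp
    moreover have "ln (16 / 27) = 4 * ln 2 - 3 * ln (3 :: real)"
      using ln_realpow[of 2 4] ln_realpow[of 3 3] by (simp add: ln_div)
    moreover have "ln (4 / 3) = 2 * ln 2 - ln (3 :: real)"
      using ln_realpow[of 2 2] by (simp add: ln_div)
    ultimately show ?thesis by (simp add: algebra_simps)
  qed
  ultimately have "1 / 10 \<le> t * (8 * s / K)" using \<eta> by linarith
  then have "real K \<le> 80 * t * s" using K by (simp add: field_simps)
  then show ?thesis by (simp add: t_def)
qed

text \<open>Without memory the answer ignores the stream, but entropy 0 must be recognised exactly.\<close>

lemma space_pos:
  fixes \<alpha> c :: real and n m s :: nat
  assumes approx: "approximates_renyi P c \<alpha> n m M" and bits: "uses_bits P n m M s"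
    and M: "M \<ge> 1" and m: "m \<ge> n" and \<alpha>: "\<alpha> > 1" and n: "n \<ge> 2"
  shows "s > 0"
proof (rule ccontr)
  assume "\<not> s > 0"
  then have s0: "s = 0" by simp
  define \<sigma> where "\<sigma> = (\<lambda>J. map (\<lambda>j. (j, 1)) J @ replicate (m - length J) (1::nat, 0::int))"
  have memory: "run a (\<sigma> J) = []"
    and bound: "2 / 3 \<le> measure_pmf.prob P {a. mult_approx c (ln (length J)) (answer a (run a (\<sigma> J)))}"
    if a: "a \<in> set_pmf P" and J: "distinct J" "set J \<subseteq> {1..n}" "J \<noteq> []" for J a
  proof -
    have "length J \<le> m"
      using card_mono[OF _ J(2)] J(1) m by (simp add: distinct_card)
    then have stream: "\<sigma> J \<in> update_streams n m M"
      using J M n by (auto simp: \<sigma>_def update_streams_def)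
    then have "length (\<sigma> J) = m" by (simp add: update_streams_def)
    moreover have "length (run a (take m (\<sigma> J))) = 0"
      using bits a stream s0 unfolding uses_bits_def by blast
    ultimately show "run a (\<sigma> J) = []" by simp
    have freq: "frequency_vector (\<sigma> J) i = of_bool (i \<in> set J)" for i
      using J(1) by (simp add: \<sigma>_def frequency_vector_append frequency_vector_units frequency_vector_replicate_0)
    have supp: "{i \<in> {1..n}. frequency_vector (\<sigma> J) i = 1} = set J" using J(2) by (auto simp: freq)
    have "renyi_entropy \<alpha> n (frequency_vector (\<sigma> J)) = ln (card {i \<in> {1..n}. frequency_vector (\<sigma> J) i = 1})"
      using J(3) by (intro renyi_entropy_indicator[OF \<alpha>]) (simp_all only: supp, auto simp: freq)
    also have "\<dots> = ln (length J)" using J(1) by (simp only: supp distinct_card)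
    finally have H: "renyi_entropy \<alpha> n (frequency_vector (\<sigma> J)) = ln (length J)" .
    have "frequency_vector (\<sigma> J) (hd J) \<noteq> 0" using J(3) by (simp add: freq)
    then have "frequency_vector (\<sigma> J) \<noteq> (\<lambda>_. 0)" by metis
    then show "2 / 3 \<le> measure_pmf.prob P {a. mult_approx c (ln (length J)) (answer a (run a (\<sigma> J)))}"
      using approx stream unfolding approximates_renyi_def H[symmetric] by blast
  qed
  obtain a0 where a0: "a0 \<in> set_pmf P" using set_pmf_not_empty[of P] by blast
  \<comment> \<open>One insertion has entropy 0 and forces the answer 0; two distinct ones have
    entropy ln 2 and forbid it. With empty memory the answer is the same, so complementary events
    would both have probability 2/3.\<close>
  let ?Z = "{a. answer a [] = 0}"
  have "2 / 3 \<le> measure_pmf.prob P {a. mult_approx c (ln (length [1::nat])) (answer a (run a (\<sigma> [1])))}"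
    by (rule bound[OF a0]) (use n in auto)
  also have "\<dots> \<le> measure_pmf.prob P ?Z"
    by (intro measure_pmf.finite_measure_mono_AE)
      (use memory[of _ "[1]"] n in \<open>auto simp: AE_measure_pmf_iff mult_approx_def\<close>)
  finally have "2 / 3 \<le> measure_pmf.prob P ?Z" .
  moreover have "2 / 3 \<le> measure_pmf.prob P {a. mult_approx c (ln (length [1::nat, 2])) (answer a (run a (\<sigma> [1, 2])))}"
    by (rule bound[OF a0]) (use n in auto)
  then have "2 / 3 \<le> measure_pmf.prob P (UNIV - ?Z)"
  proof (rule order_trans)
    show "measure_pmf.prob P {a. mult_approx c (ln (length [1::nat, 2])) (answer a (run a (\<sigma> [1, 2])))}
        \<le> measure_pmf.prob P (UNIV - ?Z)"
      by (intro measure_pmf.finite_measure_mono_AE)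
        (use memory[of _ "[1, 2]"] n in \<open>auto simp: AE_measure_pmf_iff mult_approx_def\<close>)
  qed
  ultimately show False
    using measure_pmf.prob_compl[of ?Z P] by simp
qed

section \<open>Choice of parameters and the asymptotic bound\<close>

text \<open>The weight \<open>u\<close> is just above twice n^(\<epsilon> + 1/\<alpha>) and
  \<open>K\<close> is as large as fits. Then n \<le> 16 u K and K \<le> 320 u s give n \<le> 5120
  u^2 s, and u \<le> 3 n^(\<epsilon> + 1/\<alpha>) turns 5120 into 46080.\<close>

lemma renyi_space_lower_bound:
  fixes \<alpha> \<epsilon> :: real and n m s :: nat
  assumes approx: "approximates_renyi P (1 + \<epsilon>) \<alpha> n m M" and bits: "uses_bits P n m M s"
    and M: "M \<ge> 1" and m: "m \<ge> n" and \<alpha>: "\<alpha> > 1" and \<epsilon>: "\<epsilon> > 0"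
    and n: "n \<ge> 576" "n powr (1 / \<alpha>) \<ge> 4"
  shows "real s \<ge> n powr (1 - 2 * (\<epsilon> + 1 / \<alpha>)) / 46080"
proof -
  define \<delta> where "\<delta> = \<epsilon> + 1 / \<alpha>"
  show ?thesis
  proof (cases "2 * \<delta> \<ge> 1")
    \<comment> \<open>The claimed bound is below 1 here, so it suffices that some memory is
      used.\<close>
    case True
    then have "n powr (1 - 2 * \<delta>) \<le> n powr 0" using n by (intro powr_mono) auto
    moreover have "s > 0" by (rule space_pos[OF approx bits M m \<alpha>]) (use n in simp)
    ultimately show ?thesis using n by (simp add: \<delta>_def)
  next
    case False
    define u where "u = nat \<lfloor>2 * n powr \<delta>\<rfloor> + 1"
    define K where "K = n div (8 * u)"
    have n0: "real n > 0" using n by simp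
    have \<delta>_ge: "1 / \<alpha> \<le> \<delta>" using \<epsilon> by (simp add: \<delta>_def)
    have n\<delta>: "n powr \<delta> \<ge> 4" using n by (intro order_trans[OF n(2) powr_mono[OF \<delta>_ge]]) simp
    have u_gt: "2 * n powr \<delta> < u" unfolding u_def using n\<delta> by linarith
    have "u \<le> 2 * n powr \<delta> + 1" unfolding u_def using n\<delta> by linarith
    then have u_le: "u \<le> 3 * n powr \<delta>" using n\<delta> by linarith
    have u8: "u \<ge> 8" using u_gt n\<delta> by linarith
    have "n powr \<delta> \<le> n powr (1 / 2)" using False n by (intro powr_mono) auto
    then have "n powr \<delta> \<le> sqrt n" using n0 by (simp add: powr_half_sqrt)
    \<comment> \<open>The threshold 576 is 24^2: with u \<le> 3 sqrt n it ensures 8 u \<le> n, hence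
      K \<ge> 1.\<close>
    moreover have "24 * sqrt n \<le> sqrt n * sqrt n"
    proof (rule mult_right_mono)
      show "24 \<le> sqrt n" using n by (intro real_le_rsqrt) simp
    qed simp
    moreover have "sqrt n * sqrt n = n" by simp
    ultimately have "real (8 * u) \<le> n" using u_le by simp
    then have un: "8 * u \<le> n" by linarith
    then have K1: "K \<ge> 1" unfolding K_def using u8 by (simp add: div_greater_zero_iff Suc_le_eq)
    have Kn: "2 * (4 * u) * K \<le> n" by (simp add: K_def)
    have "n < 8 * u * (K + 1)"
      using u8 dividend_less_div_times[of "8 * u" n] by (simp add: K_def algebra_simps)
    also have "\<dots> \<le> 8 * u * (2 * K)" using K1 by (intro mult_left_mono) auto
    finally have "n \<le> 16 * u * K" by simp
    then have nK: "real n \<le> 16 * u * K" by (metis of_nat_le_iff of_nat_mult of_nat_numeral)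

    \<comment> \<open>The gap needs C (1 - \<delta>) \<le> 1, which follows from (1 + \<epsilon>) (1
      - \<epsilon>) \<le> 1. As C \<ge> 1, the factor 2 in \<open>u\<close> pays for the ln 2 lost
      in ln (n / 2).\<close>
    define C where "C = (1 + \<epsilon>) * (\<alpha> / (\<alpha> - 1))"
    have a1: "\<alpha> / (\<alpha> - 1) \<ge> 1" using \<alpha> by simp
    have C1: "C \<ge> 1" unfolding C_def using a1 \<epsilon> mult_mono[of 1 "1 + \<epsilon>" 1 "\<alpha> / (\<alpha> - 1)"] by simp
    have "\<alpha> / (\<alpha> - 1) * (1 - \<delta>) = 1 - \<epsilon> * (\<alpha> / (\<alpha> - 1))"
      using \<alpha> by (simp add: \<delta>_def field_simps)
    moreover have "\<epsilon> * (\<alpha> / (\<alpha> - 1)) \<ge> \<epsilon>"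
      using mult_left_mono[OF a1, of \<epsilon>] \<epsilon> by simp
    ultimately have "\<alpha> / (\<alpha> - 1) * (1 - \<delta>) \<le> 1 - \<epsilon>" by linarith
    then have "C * (1 - \<delta>) \<le> (1 + \<epsilon>) * (1 - \<epsilon>)"
      unfolding C_def mult.assoc using \<epsilon> by (intro mult_left_mono) auto
    also have "\<dots> \<le> 1" by (simp add: algebra_simps)
    finally have C2: "C * (1 - \<delta>) \<le> 1" .
    have "ln (n / u) < ln (n / (2 * n powr \<delta>))"
      using u_gt u8 n0 n\<delta> by (subst ln_less_cancel_iff) (auto intro!: divide_strict_left_mono)
    also have "\<dots> = (1 - \<delta>) * ln n - ln 2"
      using n0 by (simp add: ln_div ln_mult ln_powr algebra_simps)
    finally have "C * ln (n / u) < C * ((1 - \<delta>) * ln n - ln 2)"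
      using C1 by (intro mult_strict_left_mono) auto
    also have "\<dots> = C * (1 - \<delta>) * ln n - C * ln 2" by (simp add: algebra_simps)
    also have "\<dots> \<le> 1 * ln n - 1 * ln 2"
      using C1 C2 n by (intro diff_mono mult_right_mono) auto
    also have "\<dots> = ln (n / 2)" using n0 by (simp add: ln_div)
    finally have gap: "(1 + \<epsilon>) * (\<alpha> / (\<alpha> - 1) * ln (n / u)) < ln (n / 2)"
      by (simp add: C_def mult.assoc)
    have "real K \<le> 80 * (4 * u) * s"
      by (rule block_size_le_space[OF approx bits M m \<alpha> _ u8 K1 Kn gap]) (use \<epsilon> in simp)
    then have "16 * real u * K \<le> 16 * real u * (80 * (4 * u) * s)"
      by (intro mult_left_mono) auto
    then have "n \<le> 5120 * (real u)\<^sup>2 * s" using nK by (simp add: power2_eq_square mult_ac)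
    also have "\<dots> \<le> 5120 * (3 * n powr \<delta>)\<^sup>2 * s"
      using u_le by (intro mult_right_mono mult_left_mono power_mono) auto
    also have "\<dots> = 46080 * s * n powr (2 * \<delta>)"
      using n0 by (simp add: power_mult_distrib powr_power mult_ac)
    finally have "n / n powr (2 * \<delta>) \<le> 46080 * s" using n0 by (simp add: pos_divide_le_eq)
    moreover have "n / n powr (2 * \<delta>) = n powr (1 - 2 * \<delta>)" using n0 by (simp add: powr_diff)
    ultimately show ?thesis by (simp add: \<delta>_def)
  qed
qed

text \<open>The constant 1/46080 is absolute and the threshold on \<open>n\<close> depends on
  \<alpha> only, so the pointwise bound yields the asymptotic one even when
  \<open>\<epsilon>\<close> varies with \<open>n\<close>.\<close>

theorem mainTheorem15:
  fixes \<alpha> \<gamma> :: real and \<epsilon> :: "nat \<Rightarrow> real"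
    and P :: "nat \<Rightarrow> stream_alg pmf" and m s :: "nat \<Rightarrow> nat" and M :: "nat \<Rightarrow> int"
  assumes "\<alpha> > 2" and "\<gamma> > 0" and "\<And>n. \<epsilon> n > 0"
    and "\<And>n. m n \<ge> n" and "\<And>n. M n \<ge> 1"
    and "\<And>n. approximates_renyi (P n) (1 + \<epsilon> n) \<alpha> n (m n) (M n)"
    and "\<And>n. uses_bits (P n) n (m n) (M n) (s n)"
  shows "(\<lambda>n. real (s n)) \<in> \<Omega>(\<lambda>n. real n powr (1 - 2 / \<alpha> - 2 * \<epsilon> n - \<gamma> * (\<epsilon> n + 1 / \<alpha>)))"
proof (rule landau_omega.bigI)
  have "\<forall>\<^sub>F n in sequentially. real n \<ge> 4 powr \<alpha>"
    using filterlim_real_sequentially by (simp add: filterlim_at_top)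
  then have "\<forall>\<^sub>F n in sequentially. real n powr (1 / \<alpha>) \<ge> 4"
  proof eventually_elim
    case (elim n)
    have "(4 powr \<alpha>) powr (1 / \<alpha>) \<le> real n powr (1 / \<alpha>)"
      using elim assms(1) by (intro powr_mono2) auto
    then show ?case using assms(1) by (simp add: powr_powr)
  qed
  then show "\<forall>\<^sub>F n in sequentially. norm (real (s n))
      \<ge> 1 / 46080 * norm (real n powr (1 - 2 / \<alpha> - 2 * \<epsilon> n - \<gamma> * (\<epsilon> n + 1 / \<alpha>)))"
    using eventually_ge_at_top[of 576]
  proof eventually_elim
    case (elim n)
    \<comment> \<open>The term with \<open>\<gamma>\<close> lowers the exponent, and the base is at
      least 1.\<close>
    have "real n powr (1 - 2 / \<alpha> - 2 * \<epsilon> n - \<gamma> * (\<epsilon> n + 1 / \<alpha>)) \<le> real n powr (1 - 2 * (\<epsilon> n + 1 / \<alpha>))"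
      using elim assms(1,2) assms(3)[of n] by (intro powr_mono) auto
    also have "\<dots> / 46080 \<le> s n"
      by (rule renyi_space_lower_bound[OF assms(6,7,5,4)]) (use elim assms(1) assms(3)[of n] in auto)
    finally show ?case by simp
  qed
qed simp

end
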